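(* Let $f \in \mathcal{P}^{*}$ and let $\Gamma_1,\Gamma_2$ be the first two logarithmic inverse coefficients of $f$. Then $$-\frac{1}{\sqrt{10}}\le |\Gamma_2|-|\Gamma_1|\le \frac13.$$ The inequalities are sharp: for each of the two inequalities there is a function in $\mathcal{P}^{*}$ for which equality holds.
   Context: Let $\mathbb{D}=\{z\in\mathbb{C}:|z|<1\}$. $\mathcal{S}$ is the class of functions $f$ that are analytic and univalent (injective) in $\mathbb{D}$ with expansion $f(z)=z+\sum_{n\ge 2}a_n z^n$. A Schwarz function is an analytic $\omega:\mathbb{D}\to\mathbb{C}$ with $\omega(0)=0$ and $|\omega(z)|<1$ for all $z\in\mathbb{D}$. For $g,h$ analytic in $\mathbb{D}$, $g\prec h$ ($g$ is subordinate to $h$) means that there is a Schwarz function $\omega$ with $g(z)=h(\omega(z))$ for all $z\in\mathbb{D}$. The class $\mathcal{P}^{*}$ is $$\mathcal{P}^{*}=\{f\in\mathcal{S}: f'(z)\prec e^{z}(1+\sin z),\ z\in\mathbb{D}\}.$$ For $f\in\mathcal{S}$, the inverse $f^{-1}$ is analytic in $|w|<1/4$, and the logarithmic inverse coefficients $\Gamma_n$ of $f$ are defined by $\log\frac{f^{-1}(w)}{w}=2\sum_{n=1}^{\infty}\Gamma_n w^n$, $|w|<1/4$ (branch of the logarithm vanishing at $w=0$). Explicitly, $\Gamma_1=-\tfrac12a_2$ and $\Gamma_2=-\tfrac12a_3+\tfrac34a_2^2$. *)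

theory Defs
  imports "HOL-Complex_Analysis.Complex_Analysis"
begin

text \<open>Functions on the unit disc are total functions on the complex plane; their values outside
  \<^term>\<open>ball (0::complex) 1\<close> play no role.\<close>

definition schlicht :: "(complex \<Rightarrow> complex) set" where
  "schlicht = {f. f holomorphic_on ball 0 1 \<and> inj_on f (ball 0 1) \<and> f 0 = 0 \<and> deriv f 0 = 1}"

definition schwarz_function :: "(complex \<Rightarrow> complex) \<Rightarrow> bool" where
  "schwarz_function \<omega> \<longleftrightarrow>
     \<omega> holomorphic_on ball 0 1 \<and> \<omega> 0 = 0 \<and> (\<forall>z\<in>ball 0 1. norm (\<omega> z) < 1)"

definition subordinate :: "(complex \<Rightarrow> complex) \<Rightarrow> (complex \<Rightarrow> complex) \<Rightarrow> bool" where
  "subordinate g h \<longleftrightarrow>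
     g holomorphic_on ball 0 1 \<and> h holomorphic_on ball 0 1 \<and>
     (\<exists>\<omega>. schwarz_function \<omega> \<and> (\<forall>z\<in>ball 0 1. g z = h (\<omega> z)))"

definition P_star :: "(complex \<Rightarrow> complex) set" where
  "P_star = {f \<in> schlicht. subordinate (deriv f) (\<lambda>z. exp z * (1 + sin z))}"

definition disc_inverse :: "(complex \<Rightarrow> complex) \<Rightarrow> complex \<Rightarrow> complex" where
  "disc_inverse f = the_inv_into (ball 0 1) f"

text \<open>
  The quotient of \<^term>\<open>disc_inverse f w\<close> by \<open>w\<close> has a removable singularity at 0 with value 1, and
  the principal logarithm of it is, near 0, the branch that vanishes at 0. Halving its Taylor
  coefficients at 0 gives the logarithmic inverse coefficients. The Taylor coefficients only depend
  on the germ at 0; the lemma after the definition shows that they are the coefficients in the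
  expansion on the disc of radius 1/4.
\<close>
definition log_inverse_coeff :: "(complex \<Rightarrow> complex) \<Rightarrow> nat \<Rightarrow> complex" where
  "log_inverse_coeff f n =
     fps_nth (fps_expansion (\<lambda>w. Ln (if w = 0 then 1 else disc_inverse f w / w)) 0) n / 2"

lemma log_inverse_coeff_unique:
  fixes L :: "complex \<Rightarrow> complex" and \<Gamma> :: "nat \<Rightarrow> complex"
  assumes holo: "L holomorphic_on ball 0 (1/4)" and L0: "L 0 = 0"
    and exp_L: "\<And>w. w \<in> ball 0 (1/4) - {0} \<Longrightarrow> exp (L w) = disc_inverse f w / w"
    and series: "\<And>w. w \<in> ball 0 (1/4) \<Longrightarrow> (\<lambda>n. 2 * \<Gamma> (Suc n) * w ^ Suc n) sums L w"
    and n: "n \<ge> 1"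
  shows "\<Gamma> n = log_inverse_coeff f n"
proof -
  let ?h = "\<lambda>w. if w = 0 then 1 else disc_inverse f w / w"
  have "isCont L 0"
    using holomorphic_on_imp_continuous_on[OF holo] by (simp add: continuous_on_eq_continuous_at)
  then have "isCont (\<lambda>w. norm (L w)) 0"
    by (rule continuous_norm)
  then have "((\<lambda>w. norm (L w)) \<longlongrightarrow> norm (L 0)) (nhds 0)"
    by (simp add: isCont_def tendsto_nhds_iff)
  then have "eventually (\<lambda>w. norm (L w) < pi) (nhds 0)"
    by (rule order_tendstoD(2)) (simp add: L0)
  moreover have "eventually (\<lambda>w. w \<in> ball 0 (1/4)) (nhds (0::complex))"
    by (intro eventually_nhds_in_open) auto
  ultimately have "eventually (\<lambda>w. Ln (?h w) = L w) (nhds 0)"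
  proof eventually_elim
    case (elim w)
    have h: "?h w = exp (L w)"
      using elim(2) exp_L[of w] L0 by (cases "w = 0") simp_all
    have "\<bar>Im (L w)\<bar> < pi"
      using elim(1) abs_Im_le_cmod[of "L w"] by linarith
    then have "Ln (exp (L w)) = L w"
      by (intro Ln_exp) linarith+
    then show ?case
      by (simp only: h)
  qed
  then have expansion: "fps_expansion (\<lambda>w. Ln (?h w)) 0 = fps_expansion L 0"
    by (rule fps_expansion_cong)
  define c where "c = (\<lambda>n. if n = 0 then 0 else 2 * \<Gamma> n)"
  have "(\<lambda>n. c n * (w - 0) ^ n) sums L w" if "w \<in> ball 0 (1/4)" for w
  proof -
    have "(\<lambda>n. c (Suc n) * w ^ Suc n) sums (L w - c 0 * w ^ 0)"
      using series[OF that] by (simp add: c_def)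
    then show ?thesis
      using sums_Suc_iff[of "\<lambda>n. c n * w ^ n" "L w - c 0 * w ^ 0"] by simp
  qed
  then have "eventually (\<lambda>w. (\<lambda>n. fps_nth (Abs_fps c) n * w ^ n) sums L w) (nhds 0)"
    using eventually_nhds_in_open[of "ball (0::complex) (1/4)" 0]
    by (auto elim!: eventually_mono)
  then have "L has_fps_expansion Abs_fps c"
    by (rule has_fps_expansionI)

  then have "fps_expansion L 0 = Abs_fps c"
    by (rule fps_expansion_eqI)
  then show ?thesis
    using n expansion by (simp add: log_inverse_coeff_def c_def)
qed

end

theory Submission
  imports Defs
begin

text \<open>
  Write \<open>\<phi> w = e\<^sup>w (1 + sin w)\<close>. If \<open>f' = \<phi> \<circ> \<omega>\<close> with a Schwarz function
  \<open>\<omega> z = c z + d z\<^sup>2 + \<dots>\<close>, comparing coefficients gives \<open>\<Gamma>\<^sub>1 = - c / 2\<close> and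
  \<open>\<Gamma>\<^sub>2 = c\<^sup>2 / 2 - d / 3\<close> (\<open>log_inverse_coeff_subordinate\<close>). The Schwarz-Pick inequality
  \<open>\<bar>d\<bar> \<le> 1 - \<bar>c\<bar>\<^sup>2\<close> (\<open>schwarz_coefficients\<close>) reduces both bounds to elementary estimates in
  \<open>\<bar>c\<bar>\<close> (\<open>coefficient_estimate\<close>). Equality forces, up to rotation, \<open>\<omega> z = z (z + a) / (1 + a z)\<close>
  with \<open>a = 0\<close> for the upper bound and \<open>a\<^sup>2 = 2/5\<close> for the lower one.

  The substance of the proof is that the two functions \<open>f\<close> belonging to these \<open>\<omega>\<close> are univalent. The
  usual criteria fail: \<open>Re f'\<close> changes sign, and \<open>f\<close> is not even close-to-convex, because the
  complement of the image reaches into it as a finger which is slightly thicker at its tip than at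
  its neck. Put \<open>k = sqrt (1 - a\<^sup>2)\<close> and let \<open>T = - a + i k\<close>, the point of the unit circle in the
  upper half plane at which \<open>\<omega> = - 1\<close>; the finger ends at \<open>f T\<close>. The function \<open>\<phi>\<close> is the square of
  a function close to \<open>(1 + w/2)\<^sup>2\<close>, so its argument lies between 0 and \<open>3\<pi>/4\<close> on the upper half disc.
  Hence \<open>f'\<close> has its values in a half plane on each of two convex parts of the upper half
  disc, to the right of the vertical line through \<open>T\<close> and to the left of the ray from 0 through \<open>T\<close>
  (\<open>inj_right_part\<close>, \<open>inj_left_part\<close>). A pair of points that lies in neither part is separated by the
  functional \<open>J z = Im (cnj T * f z)\<close>, that is, by a line along the axis of the finger: \<open>J\<close> increases
  in direction \<open>T\<close> on the right and decreases on the left, so it suffices to compare \<open>J\<close> with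
  \<open>J T\<close> on the unit circle. Finally \<open>Im f > 0\<close> on the upper half disc (\<open>Im_f_pos\<close>), and reflection
  gives univalence on the whole disc (\<open>inj_disc\<close>).

  The comparison on the circle is a quantitative matter, as the neck of the finger is narrow. The
  circle is parametrized by \<open>s \<mapsto> (T - s) / (1 - T s)\<close> with real \<open>s\<close>; then \<open>\<omega>\<close> is a quotient of
  quadratic polynomials, and after replacing \<open>\<phi>\<close> by a Taylor polynomial the derivative of \<open>J\<close> is a
  rational function of \<open>s\<close>. It is bounded below by a polynomial with nonnegative primitive. Each of
  these facts amounts to nonnegativity of an integer polynomial on the unit interval, which is
  certified by the signs of Bernstein coefficients (\<open>nonneg_cert_sound\<close>).
\<close>

section \<open>Certified nonnegativity of integer polynomials on the unit interval\<close>

text \<open>Polynomials are lists of integer coefficients, lowest degree first, so that certificates are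
  checked by symbolic evaluation.\<close>

fun ip_eval :: "int list \<Rightarrow> real \<Rightarrow> real" where
  "ip_eval [] x = 0"
| "ip_eval (a # p) x = of_int a + x * ip_eval p x"

fun ip_add :: "int list \<Rightarrow> int list \<Rightarrow> int list" where
  "ip_add [] q = q"
| "ip_add p [] = p"
| "ip_add (a # p) (b # q) = (a + b) # ip_add p q"

definition ip_scale :: "int \<Rightarrow> int list \<Rightarrow> int list" where
  "ip_scale c p = map ((*) c) p"

fun ip_mult :: "int list \<Rightarrow> int list \<Rightarrow> int list" where
  "ip_mult [] q = []"
| "ip_mult (a # p) q = ip_add (ip_scale a q) (0 # ip_mult p q)"

fun ip_power :: "int list \<Rightarrow> nat \<Rightarrow> int list" where
  "ip_power p 0 = [1]"
| "ip_power p (Suc n) = ip_mult p (ip_power p n)"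

lemma ip_eval_add [simp]: "ip_eval (ip_add p q) x = ip_eval p x + ip_eval q x"
  by (induction p q rule: ip_add.induct) (simp_all add: algebra_simps)

lemma ip_eval_scale [simp]: "ip_eval (ip_scale c p) x = of_int c * ip_eval p x"
  by (induction p) (simp_all add: ip_scale_def algebra_simps)

lemma ip_eval_mult [simp]: "ip_eval (ip_mult p q) x = ip_eval p x * ip_eval q x"
  by (induction p) (simp_all add: algebra_simps)

lemma ip_eval_power [simp]: "ip_eval (ip_power p n) x = ip_eval p x ^ n"
  by (induction n) simp_all

text \<open>The first component consists of the coefficients of \<open>(1 + v)\<^sup>N p (v / (1 + v))\<close> for a list of
  length \<open>N + 1\<close>, which are the Bernstein coefficients of \<open>p\<close> up to positive factors. The second
  component is \<open>(1 + v)\<^bsup>N + 1\<^esup>\<close>, carried along to avoid recomputing powers.\<close>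

fun bernstein :: "int list \<Rightarrow> int list \<times> int list" where
  "bernstein [] = ([], [1])"
| "bernstein (a # p) = (let (b, r) = bernstein p in (ip_add (ip_scale a r) (0 # b), ip_add r (0 # r)))"

lemma ip_eval_bernstein:
  assumes "v \<ge> 0"
  shows "ip_eval (snd (bernstein p)) v = (1 + v) ^ length p"
    and "(1 + v) * ip_eval (fst (bernstein p)) v = (1 + v) ^ length p * ip_eval p (v / (1 + v))"
proof (induction p)
  case (Cons a p)
  obtain b r where br: "bernstein p = (b, r)"
    by fastforce
  {
    case 1
    show ?case
      using Cons by (simp add: br algebra_simps)
  next
    case 2
    have "(1 + v) * ip_eval (fst (bernstein (a # p))) v
        = of_int a * (1 + v) ^ Suc (length p) + v * ((1 + v) * ip_eval b v)"
      using Cons by (simp add: br algebra_simps)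
    also have "\<dots> = (1 + v) ^ length (a # p) * ip_eval (a # p) (v / (1 + v))"
      using Cons assms by (simp add: br field_simps)
    finally show ?case .
  }
qed simp_all

lemma ip_eval_nonneg: "list_all (\<lambda>a. a \<ge> 0) p \<Longrightarrow> x \<ge> 0 \<Longrightarrow> ip_eval p x \<ge> 0"
  by (induction p) simp_all

text \<open>Scaling by a power of two keeps the coefficients of \<open>p (x / 2)\<close> integral.\<close>

fun ip_half :: "int list \<Rightarrow> int list \<times> int" where
  "ip_half [] = ([], 1)"
| "ip_half (a # p) = (let (q, c) = ip_half p in ((a * c) # q, 2 * c))"

lemma ip_eval_half:
  "snd (ip_half p) = 2 ^ length p"
  "2 * ip_eval (fst (ip_half p)) x = 2 ^ length p * ip_eval p (x / 2)"
proof (induction p)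
  case (Cons a p)
  obtain q c where qc: "ip_half p = (q, c)"
    by fastforce
  {
    case 1
    show ?case
      using Cons by (simp add: qc)
  next
    case 2
    have "2 * ip_eval (fst (ip_half (a # p))) x = 2 * 2 ^ length p * of_int a + x * (2 * ip_eval q x)"
      using Cons by (simp add: qc algebra_simps)
    then show ?case
      using Cons by (simp add: qc algebra_simps)
  }
qed simp_all

fun ip_shift :: "int list \<Rightarrow> int list" where
  "ip_shift [] = []"
| "ip_shift (a # p) = (let q = ip_shift p in ip_add (a # q) q)"

lemma ip_eval_shift: "ip_eval (ip_shift p) x = ip_eval p (1 + x)"
  by (induction p) (simp_all add: Let_def algebra_simps)

text \<open>Bisection: if the Bernstein coefficients on the whole interval do not all have the right sign,
  those on sufficiently small dyadic subintervals may.\<close>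

fun nonneg_cert :: "nat \<Rightarrow> int list \<Rightarrow> bool" where
  "nonneg_cert 0 p \<longleftrightarrow> list_all (\<lambda>a. a \<ge> 0) (fst (bernstein p))"
| "nonneg_cert (Suc n) p \<longleftrightarrow>
     (let q = fst (ip_half p) in nonneg_cert n q \<and> nonneg_cert n (ip_shift q))"

lemma nonneg_cert_sound_less:
  assumes "nonneg_cert n p" "0 \<le> x" "x < 1"
  shows "ip_eval p x \<ge> 0"
  using assms
proof (induction n arbitrary: p x)
  case 0
  define v where "v = x / (1 - x)"
  have v: "v \<ge> 0" "v / (1 + v) = x"
    using 0 by (simp_all add: v_def field_simps)
  have "0 \<le> (1 + v) * ip_eval (fst (bernstein p)) v"
    using 0 v by (intro mult_nonneg_nonneg ip_eval_nonneg) auto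
  then have "0 \<le> (1 + v) ^ length p * ip_eval p x"
    using ip_eval_bernstein(2)[OF v(1)] v(2) by simp
  moreover have "(1 + v) ^ length p > 0"
    using v by simp
  ultimately show ?case
    using zero_le_mult_iff[of "(1 + v) ^ length p" "ip_eval p x"] by linarith
next
  case (Suc n)
  let ?q = "fst (ip_half p)"
  have "0 \<le> 2 ^ length p * ip_eval p x"
  proof (cases "x < 1/2")
    case True
    then show ?thesis
      using Suc.IH[of ?q "2 * x"] Suc.prems ip_eval_half(2)[of p "2 * x"] by (simp add: Let_def)
  next
    case False
    then show ?thesis
      using Suc.IH[of "ip_shift ?q" "2 * x - 1"] Suc.prems ip_eval_half(2)[of p "2 * x"]
      by (simp add: ip_eval_shift Let_def)
  qed
  then show ?case
    using zero_less_power[of "2::real" "length p"] by (simp only: zero_le_mult_iff) linarith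
qed

lemma continuous_ip_eval: "continuous_on S (\<lambda>x. ip_eval p x)"
proof (induction p)
  case (Cons a p)
  then show ?case
    by (simp add: continuous_intros)
qed simp

text \<open>The substitution \<open>x = v / (1 + v)\<close> reaches the half-open interval only; the right end point
  follows by continuity.\<close>

theorem nonneg_cert_sound:
  assumes "nonneg_cert n p" "0 \<le> x" "x \<le> 1"
  shows "ip_eval p x \<ge> 0"
proof (rule continuous_ge_on_closure[where S = "{0..<1}" and f = "\<lambda>x. ip_eval p x"])
  show "x \<in> closure {0..<1}"
    using assms(2,3) by simp
qed (use nonneg_cert_sound_less[OF assms(1)] continuous_ip_eval in auto)

section \<open>Taylor estimates for the superordinate function\<close>

definition phi :: "complex \<Rightarrow> complex" where
  "phi w = exp w * (1 + sin w)"

text \<open>A square root of \<open>\<phi>\<close>; its power series starts with \<open>1 + w + w\<^sup>2/4 - w\<^sup>4/96\<close>, so it is close to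
  \<open>(1 + w/2)\<^sup>2\<close> on the unit disc.\<close>

definition phi_root :: "complex \<Rightarrow> complex" where
  "phi_root w = exp (w / 2) * (cos (w / 2) + sin (w / 2))"

lemma phi_eq_square: "phi w = phi_root w ^ 2"
proof -
  have "sin w = 2 * sin (w / 2) * cos (w / 2)" "exp w = exp (w / 2) ^ 2"
    using sin_double[of "w / 2"] exp_double[of "w / 2"] by simp_all
  moreover have "(cos (w / 2) + sin (w / 2)) ^ 2
      = (sin (w / 2) ^ 2 + cos (w / 2) ^ 2) + 2 * sin (w / 2) * cos (w / 2)"
    by (simp add: power2_eq_square algebra_simps)
  ultimately show ?thesis
    by (simp add: phi_def phi_root_def power_mult_distrib)
qed

text \<open>Written as combinations of exponentials, \<open>\<phi>\<close> and its square root inherit Taylor estimates with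
  explicit remainder from the exponential function.\<close>

lemma phi_eq_exps:
  "phi w = exp w + (exp ((1 + \<i>) * w) - exp ((1 - \<i>) * w)) / (2 * \<i>)"
proof -
  have "exp ((1 + \<i>) * w) = exp w * exp (\<i> * w)" "exp ((1 - \<i>) * w) = exp w * exp (- (\<i> * w))"
    by (simp_all add: algebra_simps flip: exp_add)
  then show ?thesis
    by (simp add: phi_def sin_exp_eq field_simps)
qed

lemma phi_root_eq_exps:
  "phi_root w = ((1 - \<i>) * exp ((1 + \<i>) / 2 * w) + (1 + \<i>) * exp ((1 - \<i>) / 2 * w)) / 2"
proof -
  have e: "exp ((1 + \<i>) / 2 * w) = exp (w / 2) * exp (\<i> * (w / 2))"
     "exp ((1 - \<i>) / 2 * w) = exp (w / 2) * exp (- (\<i> * (w / 2)))"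
    by (simp_all add: algebra_simps diff_divide_distrib add_divide_distrib flip: exp_add)
  show ?thesis
    unfolding phi_root_def e sin_exp_eq cos_exp_eq by (simp add: field_simps)
qed

lemma exp_taylor_bound:
  fixes c w :: complex
  assumes "norm w \<le> 1" "norm c \<le> C"
  shows "norm (exp (c * w) - (\<Sum>k\<le>n. (c * w) ^ k / fact k)) \<le> exp C * C ^ Suc n / fact n"
proof -
  have le: "norm (c * w) \<le> C"
    using assms mult_mono[of "norm c" C "norm w" 1] norm_ge_zero[of c] by (simp add: norm_mult)
  have "norm (exp (c * w) - (\<Sum>k\<le>n. (c * w) ^ k / fact k)) \<le> exp (norm (c * w)) * norm (c * w) ^ Suc n / fact n"
    by (rule Taylor_exp_field)
  also have "\<dots> \<le> exp C * C ^ Suc n / fact n"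
    using le by (intro divide_right_mono mult_mono power_mono) auto
  finally show ?thesis .
qed

lemma norm_triangle_le4:
  fixes a b c d :: "'a::real_normed_vector"
  assumes "norm a \<le> A" "norm b \<le> B" "norm c \<le> C" "norm d \<le> D"
  shows "norm (a + b + c + d) \<le> A + B + C + D"
  using assms by (intro order_trans[OF norm_triangle_ineq] add_mono)

lemma one_ii_powers:
  "(1 + \<i>) ^ 2 = 2 * \<i>" "(1 + \<i>) ^ 3 = -2 + 2 * \<i>" "(1 + \<i>) ^ 4 = -4" "(1 + \<i>) ^ 5 = -4 - 4 * \<i>"
  "(1 + \<i>) ^ 6 = -8 * \<i>" "(1 + \<i>) ^ 7 = 8 - 8 * \<i>" "(1 + \<i>) ^ 8 = 16" "(1 + \<i>) ^ 9 = 16 + 16 * \<i>"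
  "(1 + \<i>) ^ 10 = 32 * \<i>"
  "(1 - \<i>) ^ 2 = -2 * \<i>" "(1 - \<i>) ^ 3 = -2 - 2 * \<i>" "(1 - \<i>) ^ 4 = -4" "(1 - \<i>) ^ 5 = -4 + 4 * \<i>"
  "(1 - \<i>) ^ 6 = 8 * \<i>" "(1 - \<i>) ^ 7 = 8 + 8 * \<i>" "(1 - \<i>) ^ 8 = 16" "(1 - \<i>) ^ 9 = 16 - 16 * \<i>"
  "(1 - \<i>) ^ 10 = -32 * \<i>"
  by (simp_all add: eval_nat_numeral complex_eq_iff)

lemma norm_one_ii: "norm (1 + \<i>) \<le> 1.4143" "norm (1 - \<i>) \<le> 1.4143"
proof -
  have "sqrt 2 \<le> 1.4143"
    by (rule real_le_lsqrt) (simp_all add: power2_eq_square)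
  then show "norm (1 + \<i>) \<le> 1.4143" "norm (1 - \<i>) \<le> 1.4143"
    by (simp_all add: cmod_def)
qed

lemma exp_bounds: "exp (1.4143::real) \<le> 9" "exp (0.70715::real) \<le> 3"
proof -
  have "exp (2::real) = exp 1 ^ 2"
    by (simp flip: exp_double)
  also have "\<dots> \<le> 3 ^ 2"
    by (intro power_mono exp_le) auto
  finally have "exp (2::real) \<le> 9" by simp
  moreover have "exp (1.4143::real) \<le> exp 2" "exp (0.70715::real) \<le> exp 1"
    by simp_all
  ultimately show "exp (1.4143::real) \<le> 9" "exp (0.70715::real) \<le> 3"
    using exp_le by linarith+
qed

definition phi_taylor :: "complex \<Rightarrow> complex" where
  "phi_taylor w = 1 + 2 * w + 3/2 * w^2 + w^3 / 2 + w^4 / 24 - w^5 / 40 - 7/720 * w^6 - w^7 / 720"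

lemma phi_taylor_error:
  assumes w: "norm w \<le> 1"
  shows "norm (phi w - phi_taylor w) \<le> 1 / 2000"
proof -
  define T where "T c = (\<Sum>k\<le>10. (c * w) ^ k / fact k)" for c :: complex
  have T1: "norm (exp w - T 1) \<le> 3 / 3628800"
    using exp_taylor_bound[OF w, of 1 1 10] exp_le by (simp add: T_def fact_numeral)
  have "norm (exp (c * w) - T c) \<le> 9 * 1.4143 ^ 11 / 3628800" if "norm c \<le> 1.4143" for c
  proof -
    have "norm (exp (c * w) - T c) \<le> exp 1.4143 * 1.4143 ^ Suc 10 / fact 10"
      unfolding T_def by (rule exp_taylor_bound[OF w that])
    also have "\<dots> \<le> 9 * 1.4143 ^ Suc 10 / fact 10"
      using exp_bounds by (intro divide_right_mono mult_right_mono) auto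
    finally show ?thesis by (simp add: fact_numeral)
  qed
  moreover have "9 * 1.4143 ^ 11 / 3628800 \<le> (0.00012::real)"
    by (simp add: eval_nat_numeral)
  ultimately have T2: "norm (exp ((1 + \<i>) * w) - T (1 + \<i>)) \<le> 0.00012"
      "norm (exp ((1 - \<i>) * w) - T (1 - \<i>)) \<le> 0.00012"
    using norm_one_ii by (meson order_trans)+
  have "T 1 + (T (1 + \<i>) - T (1 - \<i>)) / (2 * \<i>) - phi_taylor w
     = w^8 / 40320 + 17 / 362880 * w^9 + 33 / 3628800 * w^10"
    unfolding T_def phi_taylor_def power_mult_distrib
    by (simp add: atMost_nat_numeral fact_numeral one_ii_powers, simp add: field_simps)
  moreover have "norm (w^8 / 40320 + 17 / 362880 * w^9 + 33 / 3628800 * w^10) \<le> 1 / 40320 + 17 / 362880 + 33 / 3628800"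
    using w by (intro norm_triangle_mono) (auto simp: norm_mult norm_divide norm_power power_le_one)
  ultimately have T3: "norm (T 1 + (T (1 + \<i>) - T (1 - \<i>)) / (2 * \<i>) - phi_taylor w) \<le> 0.0001"
    by simp
  have "phi w - phi_taylor w = (exp w - T 1) + (exp ((1 + \<i>) * w) - T (1 + \<i>)) / (2 * \<i>)
     + - ((exp ((1 - \<i>) * w) - T (1 - \<i>)) / (2 * \<i>))
     + (T 1 + (T (1 + \<i>) - T (1 - \<i>)) / (2 * \<i>) - phi_taylor w)"
    by (simp add: phi_eq_exps field_simps)
  also have "norm \<dots> \<le> 3 / 3628800 + 0.00012 / 2 + 0.00012 / 2 + 0.0001"
    using T2 by (intro norm_triangle_le4 T1 T3) (simp_all add: norm_divide norm_mult)
  finally show ?thesis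
    by (rule order_trans) simp
qed

lemma phi_root_error:
  assumes w: "norm w \<le> 1"
  shows "norm (phi_root w - (1 + w / 2) ^ 2) \<le> 33/2500"
proof -
  define T where "T c = (\<Sum>k\<le>6. (c * w) ^ k / fact k)" for c :: complex
  have "norm (exp (c * w) - T c) \<le> 3 * 0.70715 ^ 7 / 720" if "norm c \<le> 0.70715" for c
  proof -
    have "norm (exp (c * w) - T c) \<le> exp 0.70715 * 0.70715 ^ Suc 6 / fact 6"
      unfolding T_def by (rule exp_taylor_bound[OF w that])
    also have "\<dots> \<le> 3 * 0.70715 ^ Suc 6 / fact 6"
      using exp_bounds by (intro divide_right_mono mult_right_mono) auto
    finally show ?thesis by (simp add: fact_numeral)
  qed
  moreover have "3 * 0.70715 ^ 7 / 720 \<le> (0.00037::real)"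
    by (simp add: eval_nat_numeral)
  moreover have half_norm: "norm ((1 + \<i>) / 2) \<le> 0.70715" "norm ((1 - \<i>) / 2) \<le> 0.70715"
    using norm_one_ii by (simp_all add: norm_divide)
  ultimately have T2: "norm (exp ((1 + \<i>) / 2 * w) - T ((1 + \<i>) / 2)) \<le> 0.00037"
      "norm (exp ((1 - \<i>) / 2 * w) - T ((1 - \<i>) / 2)) \<le> 0.00037"
    by (meson order_trans)+
  have "((1 - \<i>) * T ((1 + \<i>) / 2) + (1 + \<i>) * T ((1 - \<i>) / 2)) / 2 - (1 + w / 2) ^ 2
     = - (w^4 / 96) - w^5 / 480 - w^6 / 5760"
    unfolding T_def power_mult_distrib power_divide
    by (simp add: atMost_nat_numeral fact_numeral one_ii_powers, simp add: field_simps power2_eq_square)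
  moreover have "norm (- (w^4 / 96) - w^5 / 480 - w^6 / 5760) \<le> 1 / 96 + 1 / 480 + 1 / 5760"
    using w by (intro norm_triangle_mono order_trans[OF norm_triangle_ineq4] add_mono)
      (auto simp: norm_mult norm_divide norm_power power_le_one)
  ultimately have T3: "norm (((1 - \<i>) * T ((1 + \<i>) / 2) + (1 + \<i>) * T ((1 - \<i>) / 2)) / 2 - (1 + w / 2) ^ 2) \<le> 0.012674"
    by simp
  show ?thesis
  proof (rule order_trans)
    have eq: "phi_root w - (1 + w / 2) ^ 2 = 0 + (1 - \<i>) / 2 * (exp ((1 + \<i>) / 2 * w) - T ((1 + \<i>) / 2))
     + (1 + \<i>) / 2 * (exp ((1 - \<i>) / 2 * w) - T ((1 - \<i>) / 2))
     + (((1 - \<i>) * T ((1 + \<i>) / 2) + (1 + \<i>) * T ((1 - \<i>) / 2)) / 2 - (1 + w / 2) ^ 2)"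
      unfolding phi_root_eq_exps by (simp add: field_simps)
    have "norm ((1 - \<i>) / 2 * (exp ((1 + \<i>) / 2 * w) - T ((1 + \<i>) / 2))) \<le> 0.70715 * 0.00037"
        "norm ((1 + \<i>) / 2 * (exp ((1 - \<i>) / 2 * w) - T ((1 - \<i>) / 2))) \<le> 0.70715 * 0.00037"
      unfolding norm_mult by (intro mult_mono half_norm T2; simp)+
    then show "norm (phi_root w - (1 + w / 2) ^ 2) \<le> 0 + 0.70715 * 0.00037 + 0.70715 * 0.00037 + 0.012674"
      unfolding eq using T3 by (intro norm_triangle_le4) simp_all
  qed simp
qed

lemma phi_root_deriv:
  "(phi_root has_field_derivative (exp ((1 + \<i>) / 2 * w) + exp ((1 - \<i>) / 2 * w)) / 2) (at w)"
  unfolding phi_root_eq_exps[abs_def]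
  by (auto intro!: derivative_eq_intros simp: field_simps)

lemma phi_root_deriv_error:
  assumes w: "norm w \<le> 1"
  shows "norm ((exp ((1 + \<i>) / 2 * w) + exp ((1 - \<i>) / 2 * w)) / 2 - (1 + w / 2)) \<le> 27/500"
proof -
  define T where "T c = (\<Sum>k\<le>6. (c * w) ^ k / fact k)" for c :: complex
  have "norm (exp (c * w) - T c) \<le> 3 * 0.70715 ^ 7 / 720" if "norm c \<le> 0.70715" for c
  proof -
    have "norm (exp (c * w) - T c) \<le> exp 0.70715 * 0.70715 ^ Suc 6 / fact 6"
      unfolding T_def by (rule exp_taylor_bound[OF w that])
    also have "\<dots> \<le> 3 * 0.70715 ^ Suc 6 / fact 6"
      using exp_bounds by (intro divide_right_mono mult_right_mono) auto
    finally show ?thesis by (simp add: fact_numeral)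
  qed
  moreover have "3 * 0.70715 ^ 7 / 720 \<le> (0.00037::real)"
    by (simp add: eval_nat_numeral)
  moreover have half_norm: "norm ((1 + \<i>) / 2) \<le> 0.70715" "norm ((1 - \<i>) / 2) \<le> 0.70715"
    using norm_one_ii by (simp_all add: norm_divide)
  ultimately have T2: "norm (exp ((1 + \<i>) / 2 * w) - T ((1 + \<i>) / 2)) \<le> 0.00037"
      "norm (exp ((1 - \<i>) / 2 * w) - T ((1 - \<i>) / 2)) \<le> 0.00037"
    by (meson order_trans)+
  have "(T ((1 + \<i>) / 2) + T ((1 - \<i>) / 2)) / 2 - (1 + w / 2) = - (w^3 / 24) - w^4 / 96 - w^5 / 960"
    unfolding T_def power_mult_distrib power_divide
    by (simp add: atMost_nat_numeral fact_numeral one_ii_powers, simp add: field_simps power2_eq_square)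
  moreover have "norm (- (w^3 / 24) - w^4 / 96 - w^5 / 960) \<le> 1 / 24 + 1 / 96 + 1 / 960"
    using w by (intro norm_triangle_mono order_trans[OF norm_triangle_ineq4] add_mono)
      (auto simp: norm_mult norm_divide norm_power power_le_one)
  ultimately have T3: "norm ((T ((1 + \<i>) / 2) + T ((1 - \<i>) / 2)) / 2 - (1 + w / 2)) \<le> 0.05313"
    by simp
  show ?thesis
  proof (rule order_trans)
    have eq: "(exp ((1 + \<i>) / 2 * w) + exp ((1 - \<i>) / 2 * w)) / 2 - (1 + w / 2)
     = 0 + 1 / 2 * (exp ((1 + \<i>) / 2 * w) - T ((1 + \<i>) / 2)) + 1 / 2 * (exp ((1 - \<i>) / 2 * w) - T ((1 - \<i>) / 2))
     + ((T ((1 + \<i>) / 2) + T ((1 - \<i>) / 2)) / 2 - (1 + w / 2))"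
      by (simp add: field_simps)
    show "norm ((exp ((1 + \<i>) / 2 * w) + exp ((1 - \<i>) / 2 * w)) / 2 - (1 + w / 2))
        \<le> 0 + 1 / 2 * 0.00037 + 1 / 2 * 0.00037 + 0.05313"
      unfolding eq using T3 T2 by (intro norm_triangle_le4) (simp_all add: norm_divide norm_mult)
  qed simp
qed

section \<open>Arguments of the superordinate function on half discs\<close>

lemma phi_root_Re_error:
  assumes "norm w \<le> 1"
  shows "\<bar>Re (phi_root w) - ((2 + Re w) ^ 2 - Im w ^ 2) / 4\<bar> \<le> 33/2500"
proof -
  have "Re ((1 + w / 2) ^ 2) = ((2 + Re w) ^ 2 - Im w ^ 2) / 4"
    by (simp add: power2_eq_square field_simps)
  then show ?thesis
    using abs_Re_le_cmod[of "phi_root w - (1 + w / 2) ^ 2"] phi_root_error[OF assms]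
    unfolding minus_complex.simps by argo
qed

lemma phi_root_of_real: "phi_root (of_real x) = of_real (exp (x / 2) * (cos (x / 2) + sin (x / 2)))"
proof -
  have "of_real x / 2 = (of_real (x / 2) :: complex)"
    by simp
  then show ?thesis
    unfolding phi_root_def by (simp only: exp_of_real cos_of_real sin_of_real of_real_mult of_real_add)
qed

text \<open>Near the real axis the error of the imaginary part has to be small relative to \<open>Im w\<close>. This
  follows by integrating the error of the derivative along the vertical segment from the real axis,
  where the imaginary part vanishes.\<close>

lemma phi_root_Im_error:
  assumes w: "norm w \<le> 1"
  shows "\<bar>Im (phi_root w) - (2 + Re w) * Im w / 2\<bar> \<le> 27/500 * \<bar>Im w\<bar>"
proof -
  define r where "r = (\<lambda>w. phi_root w - (1 + w / 2) ^ 2)"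
  have "norm (r w - r (of_real (Re w))) \<le> 27/500 * norm (w - of_real (Re w))"
  proof (rule field_differentiable_bound)
    show "convex (cball (0::complex) 1)"
      by simp
    show "(r has_field_derivative (exp ((1 + \<i>) / 2 * z) + exp ((1 - \<i>) / 2 * z)) / 2 - (1 + z / 2))
        (at z within cball 0 1)" if "z \<in> cball 0 1" for z
      unfolding r_def by (auto intro!: derivative_eq_intros has_field_derivative_at_within[OF phi_root_deriv] simp: field_simps)
    show "norm ((exp ((1 + \<i>) / 2 * z) + exp ((1 - \<i>) / 2 * z)) / 2 - (1 + z / 2)) \<le> 27/500"
      if "z \<in> cball 0 1" for z
      using that by (intro phi_root_deriv_error) simp
    show "w \<in> cball 0 1" "of_real (Re w) \<in> cball (0::complex) 1"
      using w abs_Re_le_cmod[of w] by auto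
  qed
  moreover have "norm (w - of_real (Re w)) = \<bar>Im w\<bar>"
    by (simp add: cmod_eq_Im)
  moreover have "Im (r (of_real (Re w))) = 0"
    by (simp add: r_def phi_root_of_real power2_eq_square)
  moreover have "Im (r w) = Im (phi_root w) - (2 + Re w) * Im w / 2"
    by (simp add: r_def power2_eq_square field_simps)
  ultimately show ?thesis
    using abs_Im_le_cmod[of "r w - r (of_real (Re w))"] by simp
qed

text \<open>All estimates compare with \<open>(1 + w/2)\<^sup>2\<close>. Since \<open>2 + Re w \<ge> 1\<close>, the error terms can be absorbed
  into multiples of \<open>(2 + Re w)\<^sup>2\<close>. The constants 12/5 and 207/500 lie below \<open>tan (3\<pi>/8)\<close> and
  \<open>tan (\<pi>/8)\<close>, so that squaring gives arguments below \<open>3\<pi>/4\<close> and \<open>\<pi>/4\<close>.\<close>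

lemma phi_root_upper_disc:
  assumes w: "norm w \<le> 1" and y: "Im w \<ge> 0"
  shows "Re (phi_root w) > 0" and "Im (phi_root w) \<ge> 0" and "Im w > 0 \<Longrightarrow> Im (phi_root w) > 0"
    and "Im (phi_root w) < 12/5 * Re (phi_root w)"
    and "Im w \<le> 169/1000 * (2 + Re w) \<Longrightarrow> Im (phi_root w) < 207/500 * Re (phi_root w)"
proof -
  define X where "X = 2 + Re w"
  define v where "v = Im w"
  have X: "X \<ge> 1"
    using abs_Re_le_cmod[of w] w by (simp add: X_def)
  have "norm w ^ 2 \<le> 1"
    using w by (simp add: power_le_one)
  then have "(X - 2) ^ 2 + v ^ 2 \<le> 1"
    by (simp add: X_def v_def cmod_power2)
  moreover have "(2 * X - 3) ^ 2 \<ge> 0"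
    by simp
  ultimately have v3: "3 * v ^ 2 \<le> X ^ 2"
    by (simp add: power2_eq_square algebra_simps)
  have "v ^ 2 \<le> 334084 / 1000000 * X ^ 2"
    using v3 zero_le_power2[of X] by argo
  then have "v ^ 2 \<le> (289/500 * X) ^ 2"
    by (simp add: power_mult_distrib power_divide)
  then have v578: "v \<le> 289/500 * X"
    by (rule power2_le_imp_le) (use X in simp)
  have XX: "X \<le> X ^ 2" "1 \<le> X ^ 2"
    using X self_le_power[of X 2] one_le_power[of X 2] by simp_all
  have v0: "v \<ge> 0"
    using y by (simp add: v_def)
  have p: "Re (phi_root w) \<ge> (X ^ 2 - v ^ 2) / 4 - 33/2500 * X ^ 2"
    using phi_root_Re_error[OF w] XX(2) unfolding X_def v_def by argo
  have q: "Im (phi_root w) \<le> X * v / 2 + 27/500 * v" "Im (phi_root w) \<ge> X * v / 2 - 27/500 * v"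
    using phi_root_Im_error[OF w] v0 unfolding X_def v_def by linarith+
  have p': "Re (phi_root w) \<ge> 153/1000 * X ^ 2"
    using p v3 XX(2) by argo
  then show "Re (phi_root w) > 0"
    using XX(2) by argo
  have Xv: "X * v \<ge> 1 * v"
    using X v0 by (intro mult_right_mono) auto
  show "Im (phi_root w) \<ge> 0"
    using q(2) Xv v0 by argo
  show "Im (phi_root w) > 0" if "Im w > 0"
    using q(2) Xv that[folded v_def] by argo
  have "X * v \<le> X * (289/500 * X)"
    using X v578 by (intro mult_left_mono) auto
  then have "X * v \<le> 289/500 * X ^ 2"
    by (simp add: power2_eq_square)
  then have "Im (phi_root w) \<le> 3203/10000 * X ^ 2"
    using q(1) v578 XX by argo
  then show "Im (phi_root w) < 12/5 * Re (phi_root w)"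
    using p' XX(2) by argo
  show "Im (phi_root w) < 207/500 * Re (phi_root w)" if "Im w \<le> 169/1000 * (2 + Re w)"
  proof -
    have v169: "v \<le> 169/1000 * X"
      using that by (simp add: X_def v_def)
    have "X * v \<le> X * (169/1000 * X)"
      using X v169 by (intro mult_left_mono) auto
    then have "X * v \<le> 169/1000 * X ^ 2"
      by (simp add: power2_eq_square)
    then have q': "Im (phi_root w) \<le> 937/10000 * X ^ 2"
      using q(1) v169 XX by argo
    have "v ^ 2 \<le> (169/1000 * X) ^ 2"
      using v169 v0 by (intro power_mono) auto
    then have "v ^ 2 \<le> (169/1000) ^ 2 * X ^ 2"
      by (simp only: power_mult_distrib)
    then have "v ^ 2 \<le> 28561/1000000 * X ^ 2"
      by (simp add: power2_eq_square[of "169/1000"])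
    then show ?thesis
      using p q' XX(2) by argo
  qed
qed

lemma phi_cnj: "phi (cnj w) = cnj (phi w)"
  by (simp add: phi_def exp_cnj cnj_sin)

lemma phi_upper_disc:
  assumes w: "norm w \<le> 1" and y: "Im w \<ge> 0"
  shows "Im (phi w) \<ge> 0" and "Im w > 0 \<Longrightarrow> Im (phi w) > 0"
    and "Re (phi w) + Im (phi w) > 0"
    and "Im w \<le> 169/1000 * (2 + Re w) \<Longrightarrow> Im (phi w) < Re (phi w)"
proof -
  define p where "p = Re (phi_root w)"
  define q where "q = Im (phi_root w)"
  note * = phi_root_upper_disc[OF assms, folded p_def q_def]
  have Re_phi: "Re (phi w) = p ^ 2 - q ^ 2" and Im_phi: "Im (phi w) = 2 * p * q"
    by (simp_all add: phi_eq_square p_def q_def power2_eq_square)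
  show "Im (phi w) \<ge> 0" "Im w > 0 \<Longrightarrow> Im (phi w) > 0"
    using * by (simp_all add: Im_phi)
  have p2: "p ^ 2 > 0"
    using *(1) by simp
  have "q * (q - 12/5 * p) \<le> 0"
    using * by (intro mult_nonneg_nonpos) auto
  then have "q ^ 2 \<le> 12/5 * (p * q)"
    by (simp add: power2_eq_square algebra_simps)
  moreover have "p * q \<le> p * (12/5 * p)"
    using * by (intro mult_left_mono) auto
  then have "p * q \<le> 12/5 * p ^ 2"
    by (simp add: power2_eq_square)
  ultimately show "Re (phi w) + Im (phi w) > 0"
    using p2 unfolding Re_phi Im_phi mult.assoc by argo
  show "Im (phi w) < Re (phi w)" if "Im w \<le> 169/1000 * (2 + Re w)"
  proof -
    have q: "q < 207/500 * p"
      using * that by simp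
    have "q ^ 2 \<le> (207/500 * p) ^ 2"
      using q * by (intro power_mono) auto
    then have "q ^ 2 \<le> 171396 / 1000000 * p ^ 2"
      by (simp add: power_mult_distrib power_divide)
    moreover have "p * q \<le> p * (207/500 * p)"
      using q * by (intro mult_left_mono) auto
    then have "p * q \<le> 414 / 1000 * p ^ 2"
      by (simp add: power2_eq_square)
    ultimately show ?thesis
      using p2 unfolding Re_phi Im_phi mult.assoc by argo
  qed
qed

lemma phi_lower_disc:
  assumes w: "norm w \<le> 1" and y: "Im w \<le> 0"
  shows "Im (phi w) \<le> 0"
    and "Re (phi w) - Im (phi w) > 0"
    and "- Im w \<le> 169/1000 * (2 + Re w) \<Longrightarrow> - Im (phi w) < Re (phi w)"
  using phi_upper_disc[of "cnj w"] assms by (simp_all add: phi_cnj)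

section \<open>Segments and univalence\<close>

text \<open>A mean value theorem for one real component of a holomorphic function along a segment. The
  factor \<open>c\<close> selects the component and may depend on the end points.\<close>

lemma segment_mvt:
  fixes f f' :: "complex \<Rightarrow> complex"
  assumes "convex S" "a \<in> S" "b \<in> S"
    and deriv: "\<And>z. z \<in> S \<Longrightarrow> (f has_field_derivative f' z) (at z)"
  obtains z where "z \<in> S" "z \<in> open_segment a b \<or> a = b" "Re (c * (f b - f a)) = Re (c * (b - a) * f' z)"
proof -
  define p where "p t = a + of_real t * (b - a)" for t :: real
  have p: "p t = (1 - t) *\<^sub>R a + t *\<^sub>R b" for t
    by (simp add: p_def scaleR_conv_of_real algebra_simps)
  have pS: "p t \<in> S" if "0 \<le> t" "t \<le> 1" for t
    using that assms(1-3) unfolding p by (auto intro: convexD_alt)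
  have "((\<lambda>t. Re (c * f (p t))) has_real_derivative Re (c * (b - a) * f' (p t))) (at t)"
    if "0 \<le> t" "t \<le> 1" for t
  proof -
    have "(p has_vector_derivative (b - a)) (at t)"
      unfolding p_def by (auto intro!: derivative_eq_intros)
    then have "((f \<circ> p) has_vector_derivative (b - a) * f' (p t)) (at t)"
      by (rule field_vector_diff_chain_at) (rule deriv[OF pS[OF that]])
    then have "((\<lambda>t. Re (c * (f \<circ> p) t)) has_vector_derivative Re (c * ((b - a) * f' (p t)))) (at t)"
      by (intro bounded_linear.has_vector_derivative[OF bounded_linear_Re] has_vector_derivative_mult_right)
    then show ?thesis
      by (simp add: has_real_derivative_iff_has_vector_derivative mult.assoc)
  qed
  from MVT2[OF zero_less_one this]
  obtain t where t: "0 < t" "t < 1" "Re (c * f (p 1)) - Re (c * f (p 0)) = Re (c * (b - a) * f' (p t))"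
    by auto
  show ?thesis
  proof
    show "p t \<in> S"
      using pS t by simp
    show "p t \<in> open_segment a b \<or> a = b"
      using t by (auto simp: in_segment p)
    show "Re (c * (f b - f a)) = Re (c * (b - a) * f' (p t))"
      using t(3) by (simp add: p_def algebra_simps)
  qed
qed

text \<open>The Noshiro-Warschawski criterion: taking \<open>cnj (b - a) * c\<close> as the factor in the mean value
  theorem turns \<open>f b = f a\<close> into a zero of \<open>Re (c * f')\<close>.\<close>

lemma inj_on_convex_Re_deriv_pos:
  fixes f f' :: "complex \<Rightarrow> complex"
  assumes "convex S" and "\<And>z. z \<in> S \<Longrightarrow> (f has_field_derivative f' z) (at z)"
    and pos: "\<And>z. z \<in> S \<Longrightarrow> Re (c * f' z) > 0"
  shows "inj_on f S"
proof (rule inj_onI, rule ccontr)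
  fix a b assume ab: "a \<in> S" "b \<in> S" "f a = f b" "a \<noteq> b"
  obtain z where z: "z \<in> S" "Re (cnj (b - a) * c * (f b - f a)) = Re (cnj (b - a) * c * (b - a) * f' z)"
    using segment_mvt[OF assms(1) ab(1,2) assms(2)] by metis
  have "cnj (b - a) * c * (b - a) * f' z = of_real (norm (b - a) ^ 2) * (c * f' z)"
    using complex_norm_square[of "b - a"] by (simp only: mult_ac of_real_power)
  then have "Re (of_real (norm (b - a) ^ 2) * (c * f' z)) = Re (cnj (b - a) * c * (f b - f a))"
    using z(2) by (simp only:)
  also have "\<dots> = 0"
    using ab(3) by simp
  finally have "norm (b - a) ^ 2 * Re (c * f' z) = 0"
    by (simp only: Re_complex_of_real Im_complex_of_real times_complex.simps mult_zero_left diff_zero)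
  then show False
    using pos[OF z(1)] ab(4) by auto
qed

lemma Im_directional_mono:
  fixes f f' :: "complex \<Rightarrow> complex"
  assumes "convex S" "a \<in> S" "b \<in> S"
    and "\<And>z. z \<in> S \<Longrightarrow> (f has_field_derivative f' z) (at z)"
    and "\<And>z. z \<in> open_segment a b \<Longrightarrow> z \<in> S \<Longrightarrow> Im (c * (b - a) * f' z) \<ge> 0"
  shows "Im (c * f a) \<le> Im (c * f b)"
proof (cases "a = b")
  case False
  obtain z where z: "z \<in> S" "z \<in> open_segment a b"
      "Re (- \<i> * c * (f b - f a)) = Re (- \<i> * c * (b - a) * f' z)"
    using segment_mvt[OF assms(1-3) assms(4)] False by metis
  then show ?thesis
    using assms(5)[OF z(2,1)] by (simp add: algebra_simps)
qed simp

lemma Im_directional_strict_mono: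
  fixes f f' :: "complex \<Rightarrow> complex"
  assumes "convex S" "a \<in> S" "b \<in> S" "a \<noteq> b"
    and "\<And>z. z \<in> S \<Longrightarrow> (f has_field_derivative f' z) (at z)"
    and "\<And>z. z \<in> open_segment a b \<Longrightarrow> z \<in> S \<Longrightarrow> Im (c * (b - a) * f' z) > 0"
  shows "Im (c * f a) < Im (c * f b)"
proof -
  obtain z where z: "z \<in> S" "z \<in> open_segment a b"
      "Re (- \<i> * c * (f b - f a)) = Re (- \<i> * c * (b - a) * f' z)"
    using segment_mvt[OF assms(1-3) assms(5)] assms(4) by metis
  then show ?thesis
    using assms(6)[OF z(2,1)] by (simp add: algebra_simps)
qed

section \<open>Blaschke products of degree two\<close>

definition blaschke2 :: "real \<Rightarrow> complex \<Rightarrow> complex" where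
  "blaschke2 a z = z * (z + of_real a) / (1 + of_real a * z)"

lemma blaschke2_cnj: "blaschke2 a (cnj z) = cnj (blaschke2 a z)"
  by (simp add: blaschke2_def)

text \<open>The bound \<open>a\<^sup>2 \<le> 2/5\<close> covers both extremal functions, and the geometric estimates below are uniform
  in this range.\<close>

locale narrow_parameter =
  fixes a k :: real
  assumes a_nonneg: "0 \<le> a" and k_pos: "0 < k" and ak: "a ^ 2 + k ^ 2 = 1" and a_le: "a ^ 2 \<le> 2/5"
begin

abbreviation "w \<equiv> blaschke2 a"

text \<open>The sign of \<open>side z\<close> is that of \<open>Im (w z)\<close> in the upper half disc. Its zero set is a circle
  orthogonal to the unit circle at \<open>T\<close>, a line if \<open>a = 0\<close>.\<close>

definition side :: "complex \<Rightarrow> real" where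
  "side z = 2 * Re z + a * (1 + norm z ^ 2)"

lemma k_sq: "k ^ 2 = 1 - a ^ 2"
  using ak by simp

lemma a_bounds: "a < 16/25" "a \<le> k" "a * k \<le> 49/100"
proof -
  have "a ^ 2 < (16/25) ^ 2"
    using a_le by (simp add: power2_eq_square)
  then show "a < 16/25"
    by (rule power2_less_imp_less) simp
  show "a \<le> k"
    by (rule power2_le_imp_le) (use a_le ak k_pos in auto)
  have "(2/5 - a ^ 2) * (3/5 - a ^ 2) \<ge> 0"
    using a_le by (intro mult_nonneg_nonneg) auto
  then have "(a * k) ^ 2 \<le> 6/25"
    unfolding power_mult_distrib k_sq by (simp add: algebra_simps)
  then have "(a * k) ^ 2 \<le> (49/100) ^ 2"
    by (simp add: power2_eq_square)
  then show "a * k \<le> 49/100"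
    by (rule power2_le_imp_le) simp
qed

lemma denom_nz:
  fixes z :: complex
  assumes z: "norm z < 3/2"
  shows "1 + of_real a * z \<noteq> 0"
proof
  assume "1 + of_real a * z = 0"
  then have "of_real a * z = - 1"
    by (simp add: add_eq_0_iff)
  then have "norm (of_real a * z) = 1"
    by simp
  moreover have "a * norm z \<le> 16/25 * (3/2)"
    using a_bounds a_nonneg z by (intro mult_mono) auto
  ultimately show False
    using a_nonneg by (simp add: norm_mult)
qed

lemma denom_norm_sq: "norm (1 + of_real a * z) ^ 2 = 1 + 2 * a * Re z + a ^ 2 * norm z ^ 2"
  by (simp only: cmod_power2) (simp add: power2_eq_square algebra_simps)

lemma w_times_denom:
  assumes "norm z < 3/2"
  shows "w z * of_real (norm (1 + of_real a * z) ^ 2)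
       = z ^ 2 + of_real a * z + of_real (a * norm z ^ 2) * z + of_real (a ^ 2 * norm z ^ 2)"
proof -
  have "w z * ((1 + of_real a * z) * cnj (1 + of_real a * z)) = z * (z + of_real a) * cnj (1 + of_real a * z)"
    using denom_nz[OF assms] by (simp add: blaschke2_def)
  also have "\<dots> = z ^ 2 + of_real a * z + of_real a * (z * cnj z) * z + of_real a ^ 2 * (z * cnj z)"
    by (simp add: power2_eq_square algebra_simps)
  finally show ?thesis
    unfolding complex_norm_square of_real_mult of_real_power[of a] .
qed

lemma Im_w: "norm z < 3/2 \<Longrightarrow> Im (w z) * norm (1 + of_real a * z) ^ 2 = Im z * side z"
  using arg_cong[OF w_times_denom, of z Im] by (simp add: side_def power2_eq_square algebra_simps)

lemma Re_w: "norm z < 3/2 \<Longrightarrow> Re (w z) * norm (1 + of_real a * z) ^ 2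
   = Re z ^ 2 - Im z ^ 2 + a * Re z + a * norm z ^ 2 * Re z + a ^ 2 * norm z ^ 2"
  using arg_cong[OF w_times_denom, of z Re] by (simp add: power2_eq_square algebra_simps)

lemma norm_w_le:
  assumes "norm z \<le> 1"
  shows "norm (w z) \<le> norm z"
proof -
  have "norm z ^ 2 \<le> 1"
    using assms by (simp add: power_le_one)
  then have "0 \<le> (1 - norm z ^ 2) * k ^ 2"
    by simp
  also have "\<dots> = norm (1 + of_real a * z) ^ 2 - norm (z + of_real a) ^ 2"
    unfolding k_sq cmod_power2 by (simp add: power2_eq_square algebra_simps)
  finally have "norm (z + of_real a) ^ 2 \<le> norm (1 + of_real a * z) ^ 2"
    by simp
  then have "norm (z + of_real a) \<le> norm (1 + of_real a * z)"
    by (rule power2_le_imp_le) simp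
  moreover have "norm (1 + of_real a * z) > 0"
    using denom_nz[of z] assms by simp
  ultimately have "norm (z + of_real a) / norm (1 + of_real a * z) \<le> 1"
    by simp
  then have "norm z * (norm (z + of_real a) / norm (1 + of_real a * z)) \<le> norm z * 1"
    by (intro mult_left_mono) auto
  then show ?thesis
    by (simp add: blaschke2_def norm_mult norm_divide)
qed

lemma right_of_ray:
  assumes "k * Re z + a * Im z \<ge> 0" "Im z \<ge> 0"
  shows "side z \<ge> 0"
proof -
  have "Re z \<ge> - a * norm z"
  proof (cases "Re z \<ge> 0")
    case False
    have "(k * - Re z) ^ 2 \<le> (a * Im z) ^ 2"
      using assms False mult_nonneg_nonpos[of k "Re z"] k_pos by (intro power_mono) auto
    then have "(- Re z) ^ 2 \<le> (a * norm z) ^ 2"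
      by (simp add: cmod_power2 power_mult_distrib k_sq algebra_simps)
    then have "- Re z \<le> a * norm z"
      by (rule power2_le_imp_le) (use a_nonneg in auto)
    then show ?thesis by simp
  next
    case True
    moreover have "a * norm z \<ge> 0"
      using a_nonneg by simp
    ultimately show ?thesis by simp
  qed
  then have "side z \<ge> a * (1 - norm z) ^ 2"
    by (simp add: side_def power2_eq_square algebra_simps)
  then show ?thesis
    by (rule order_trans[rotated]) (simp add: a_nonneg)
qed

lemma left_of_ray:
  assumes "k * Re z + a * Im z \<le> 0" "Im z \<ge> 0"
  shows "Re z \<le> - a * norm z" "Im z \<le> k * norm z"
proof -
  have Re: "Re z \<le> 0"
    using assms a_nonneg k_pos mult_nonneg_nonneg[of a "Im z"] mult_pos_pos[of k "Re z"] by fastforce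
  have "(a * Im z) ^ 2 \<le> (k * - Re z) ^ 2"
    using assms a_nonneg by (intro power_mono) auto
  then have "(a * norm z) ^ 2 \<le> (- Re z) ^ 2"
    by (simp add: cmod_power2 power_mult_distrib k_sq algebra_simps)
  then show "Re z \<le> - a * norm z"
    using Re power2_le_imp_le[of "a * norm z" "- Re z"] by simp
  have "(Im z) ^ 2 \<le> (k * norm z) ^ 2"
    using \<open>(a * norm z) ^ 2 \<le> (- Re z) ^ 2\<close>
    by (simp add: cmod_power2 power_mult_distrib k_sq algebra_simps)
  then show "Im z \<le> k * norm z"
    by (rule power2_le_imp_le) (use k_pos in auto)
qed

end

context narrow_parameter begin

lemma sector_cubic_bound: "x * (1 - x) ^ 2 \<le> 4/27" if "0 \<le> x" "x \<le> 1" for x :: real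
proof -
  have "(x - 1/3) ^ 2 * (4/3 - x) \<ge> 0"
    using that by (intro mult_nonneg_nonneg) auto
  then show ?thesis
    by (simp add: power2_eq_square algebra_simps)
qed

text \<open>Between the circle \<open>side z = 0\<close> and the ray through \<open>T\<close> the value \<open>w z\<close> is close to the real
  axis: there \<open>side z \<le> a (1 - \<bar>z\<bar>)\<^sup>2\<close>, and the remaining inequality in \<open>\<bar>z\<bar>\<close> is cubic.\<close>

lemma left_sector_bound:
  assumes z: "norm z \<le> 1" "Im z \<ge> 0" "k * Re z + a * Im z \<le> 0" "side z \<ge> 0"
  shows "Im (w z) \<le> 169/1000 * (2 + Re (w z))"
proof -
  define r where "r = norm z"
  define N where "N = norm (1 + of_real a * z) ^ 2"
  have r: "0 \<le> r" "r \<le> 1"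
    using z by (simp_all add: r_def)
  have ar: "0 \<le> a * r" "a * r \<le> 16/25 * r"
    using a_nonneg a_bounds r by (simp, intro mult_right_mono) auto
  have "1 - a * r \<le> norm (1 + of_real a * z)"
    using norm_triangle_ineq4[of "1 + of_real a * z" "of_real a * z"] a_nonneg
    by (simp add: norm_mult r_def)
  then have N: "(1 - a * r) ^ 2 \<le> N"
    unfolding N_def using ar r by (intro power_mono) auto
  have "side z \<le> a * (1 - r) ^ 2"
    using left_of_ray(1)[OF z(3,2)] by (simp add: side_def r_def power2_eq_square algebra_simps)
  then have "Im z * side z \<le> (k * r) * (a * (1 - r) ^ 2)"
    using left_of_ray(2)[OF z(3,2)] z a_nonneg k_pos r by (intro mult_mono) (auto simp: r_def)
  also have "\<dots> = (a * k) * (r * (1 - r) ^ 2)"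
    by simp
  also have "\<dots> \<le> 49/100 * (r * (1 - r) ^ 2)"
    using a_bounds r by (intro mult_right_mono) auto
  also have "\<dots> \<le> 169/1000 * (1 - 16/25 * r) ^ 2"
  proof (cases "r \<le> 51/100")
    case True
    have "(1 - 16/25 * (51/100)) ^ 2 \<le> (1 - 16/25 * r) ^ 2"
      using True by (intro power_mono) auto
    then show ?thesis
      using sector_cubic_bound[OF r] by (simp add: power2_eq_square[of "421/625"])
  next
    case False
    have "((1 - r) - 9/25 * r) ^ 2 \<ge> 0"
      by simp
    moreover have "((1 - r) - 9/25 * r) ^ 2 = (1 - 16/25 * r) ^ 2 - 36/25 * (r * (1 - r))"
      by (simp add: power2_eq_square field_simps)
    ultimately have "(1 - 16/25 * r) ^ 2 \<ge> 36/25 * (r * (1 - r))"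
      by linarith
    moreover have "r * (1 - r) * (1 - r) \<le> r * (1 - r) * (49/100)"
      using False r by (intro mult_left_mono) auto
    moreover have "r * (1 - r) \<ge> 0"
      using r by simp
    ultimately show ?thesis
      unfolding power2_eq_square[of "1 - r"] mult.assoc[symmetric] by (linarith | argo)
  qed
  also have "\<dots> \<le> 169/1000 * N"
  proof -
    have "(1 - 16/25 * r) ^ 2 \<le> (1 - a * r) ^ 2"
      using ar r by (intro power_mono) auto
    then show ?thesis
      using N by simp
  qed
  also have "\<dots> \<le> 169/1000 * ((2 + Re (w z)) * N)"
  proof -
    have "1 \<le> 2 + Re (w z)"
      using abs_Re_le_cmod[of "w z"] norm_w_le[OF z(1)] z(1) by linarith
    then have "1 * N \<le> (2 + Re (w z)) * N"
      unfolding N_def by (intro mult_right_mono) auto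
    then show ?thesis
      by simp
  qed
  finally have "Im (w z) * N \<le> 169/1000 * (2 + Re (w z)) * N"
    using Im_w[of z] z unfolding N_def mult.assoc[of "169/1000"] by simp
  moreover have "N > 0"
    using denom_nz[of z] z by (simp add: N_def)
  ultimately show ?thesis
    by simp
qed

text \<open>In terms of \<open>x = y / k\<close> and with \<open>a k \<le> 49/100\<close> this is a cubic inequality on the unit interval;
  its left and right sides are closest near \<open>x = 3/5\<close>.\<close>

lemma lens_cubic_bound:
  assumes "0 \<le> y" "y \<le> k"
  shows "a * (y * (k ^ 2 - y ^ 2)) \<le> 169/1000 * (2 * k ^ 4 - (1 - 2 * a ^ 2) * y ^ 2)"
proof -
  define x where "x = y / k"
  have x: "0 \<le> x" "x \<le> 1" and y: "y = k * x"
    using assms k_pos by (simp_all add: x_def)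
  have "x * x ^ 2 \<le> x * 1"
    using x by (intro mult_left_mono) (auto simp: power_le_one)
  then have x3: "x ^ 3 \<le> x"
    by (simp add: eval_nat_numeral)
  have sq: "(x - 3/5) ^ 2 * (49/100 * x + 5542/10000)
      = 49/100 * x ^ 3 - 338/10000 * x ^ 2 - 48864/100000 * x + 199512/1000000"
    by (simp add: power2_eq_square power3_eq_cube field_simps)
  have "(x - 3/5) ^ 2 * (49/100 * x + 5542/10000) \<ge> 0"
    using x by (intro mult_nonneg_nonneg) auto
  then have *: "49/100 * (x - x ^ 3) \<le> 169/1000 * (6/5 - x ^ 2 / 5)"
    using x unfolding sq by argo
  have "(a * k) * (x - x ^ 3) \<le> 49/100 * (x - x ^ 3)"
    using a_bounds x3 by (intro mult_right_mono) auto
  also note *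
  also have "6/5 - x ^ 2 / 5 \<le> 2 - 2 * a ^ 2 - x ^ 2 + 2 * a ^ 2 * x ^ 2"
  proof -
    have "(2/5 - a ^ 2) * (1 - x ^ 2) \<ge> 0"
      using a_le x by (intro mult_nonneg_nonneg) (auto simp: power_le_one)
    moreover have "(2/5 - a ^ 2) * (1 - x ^ 2) = 2/5 - 2/5 * x ^ 2 - a ^ 2 + a ^ 2 * x ^ 2"
      by (simp add: field_simps)
    ultimately show ?thesis
      unfolding mult.assoc by argo
  qed
  finally have "k ^ 2 * ((a * k) * (x - x ^ 3)) \<le> k ^ 2 * (169/1000 * (2 * k ^ 2 - (1 - 2 * a ^ 2) * x ^ 2))"
    unfolding k_sq by (intro mult_left_mono) (use a_le in \<open>auto simp: algebra_simps\<close>)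
  then show ?thesis
    unfolding y by (simp add: eval_nat_numeral algebra_simps)
qed

text \<open>The counterpart for the lens between the circle \<open>side z = 0\<close> and the vertical line through \<open>T\<close>.
  Both \<open>side z\<close> and \<open>(2 + Re (w z)) * N\<close>, with \<open>N\<close> the squared norm of the denominator, increase with
  \<open>Re z\<close>, so the worst case is the vertical line itself.\<close>

lemma lens_bound:
  assumes z: "norm z \<le> 1" "Im z \<ge> 0" "Re z \<ge> - a" "side z \<le> 0"
  shows "- Im (w z) \<le> 169/1000 * (2 + Re (w z))"
proof -
  define x where "x = Re z"
  define y where "y = Im z"
  define N where "N = norm (1 + of_real a * z) ^ 2"
  have n: "norm z ^ 2 = x ^ 2 + y ^ 2"
    by (simp add: x_def y_def cmod_power2)
  have N: "N > 0"
    using denom_nz[of z] z by (simp add: N_def)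
  have ImN: "Im (w z) * N = y * side z"
    using Im_w[of z] z by (simp add: N_def y_def)
  have Q: "(2 + Re (w z)) * N = a * x ^ 3 + (1 + 3 * a ^ 2) * x ^ 2 + (5 * a + a * y ^ 2) * x + (2 - y ^ 2 + 3 * a ^ 2 * y ^ 2)"
    (is "_ = ?Q")
  proof -
    have "Re (w z) * N = x ^ 2 - y ^ 2 + a * x + a * (x ^ 2 + y ^ 2) * x + a ^ 2 * (x ^ 2 + y ^ 2)"
      using Re_w[of z] z unfolding N_def n[symmetric] by (simp add: x_def y_def)
    moreover have "N = 1 + 2 * a * x + a ^ 2 * (x ^ 2 + y ^ 2)"
      unfolding N_def denom_norm_sq n x_def ..
    moreover have "(2 + Re (w z)) * N = 2 * N + Re (w z) * N"
      by (simp add: algebra_simps)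
    ultimately show ?thesis
      by (simp add: power2_eq_square power3_eq_cube algebra_simps)
  qed
  have xa: "x + a \<ge> 0" and y0: "y \<ge> 0"
    using z by (simp_all add: x_def y_def)
  have "- (y * side z) \<le> 169/1000 * ?Q"
  proof (cases "a = 0")
    case True
    then have "side z = 2 * x"
      unfolding side_def by (simp add: x_def)
    then have "x = 0" "side z = 0"
      using z(4) xa True by simp_all
    moreover have "y ^ 2 \<le> 1"
      using z(1) n \<open>x = 0\<close> power_le_one[of "norm z" 2] by simp
    ultimately show ?thesis
      using True by simp
  next
    case False
    have s: "side z - a * (y ^ 2 - k ^ 2) = (x + a) * (2 + a * (x - a))"
      unfolding side_def n k_sq unfolding x_def[symmetric] by (simp add: power2_eq_square algebra_simps)
    have "a * (x - a) \<ge> a * (- 2 * a)"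
      using xa a_nonneg by (intro mult_left_mono) auto
    moreover have "a * (- 2 * a) \<ge> - 4/5"
      using a_le by (simp add: power2_eq_square)
    ultimately have "(x + a) * (2 + a * (x - a)) \<ge> 0"
      using xa by (intro mult_nonneg_nonneg) auto
    then have side: "- side z \<le> a * (k ^ 2 - y ^ 2)"
      using s by (simp add: algebra_simps)
    then have "a * (k ^ 2 - y ^ 2) \<ge> 0"
      using z(4) by linarith
    then have "y ^ 2 \<le> k ^ 2"
      using False a_nonneg by (simp add: zero_le_mult_iff)
    then have yk: "y \<le> k"
      by (rule power2_le_imp_le) (use k_pos in simp)
    have "- (y * side z) = y * (- side z)"
      by simp
    also have "\<dots> \<le> y * (a * (k ^ 2 - y ^ 2))"
      using side y0 by (rule mult_left_mono)
    also have "\<dots> = a * (y * (k ^ 2 - y ^ 2))"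
      by simp
    also have "\<dots> \<le> 169/1000 * (2 * k ^ 4 - (1 - 2 * a ^ 2) * y ^ 2)"
      by (rule lens_cubic_bound[OF y0 yk])
    also have "2 * k ^ 4 - (1 - 2 * a ^ 2) * y ^ 2 \<le> ?Q"
    proof -
      have k4: "k ^ 4 = (1 - a ^ 2) ^ 2"
        by (simp flip: k_sq)
      have "?Q - (2 * k ^ 4 - (1 - 2 * a ^ 2) * y ^ 2)
          = (x + a) * (a * x ^ 2 + a * y ^ 2 + (1 + 2 * a ^ 2) * (x + a) + (3 * a - 4 * a ^ 3))"
        unfolding k4 by (simp add: power2_eq_square power3_eq_cube algebra_simps)
      moreover have "3 * a - 4 * a ^ 3 = a * (3 - 4 * a ^ 2)"
        by (simp add: power2_eq_square power3_eq_cube algebra_simps)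
      moreover have "a * (3 - 4 * a ^ 2) \<ge> 0"
        using a_nonneg a_le by (intro mult_nonneg_nonneg) auto
      moreover have "(x + a) * (a * x ^ 2 + a * y ^ 2 + (1 + 2 * a ^ 2) * (x + a) + u) \<ge> 0" if "u \<ge> 0" for u
      proof (rule mult_nonneg_nonneg[OF xa])
        have "(1 + 2 * a ^ 2) * (x + a) \<ge> 0"
          by (rule mult_nonneg_nonneg[OF _ xa]) simp
        then show "0 \<le> a * x ^ 2 + a * y ^ 2 + (1 + 2 * a ^ 2) * (x + a) + u"
          using that a_nonneg by simp
      qed
      ultimately show ?thesis
        by (metis diff_ge_0_iff_ge)
    qed
    finally show ?thesis
      by simp
  qed
  then have "(- Im (w z)) * N \<le> (169/1000 * (2 + Re (w z))) * N"
    using ImN unfolding mult.assoc[of "169/1000"] Q by simp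
  then show ?thesis
    using N by (rule mult_right_le_imp_le)
qed

end

section \<open>Half-plane conditions for the derivative\<close>

context narrow_parameter begin
lemma norm_w_le_1: "norm z \<le> 1 \<Longrightarrow> norm (w z) \<le> 1"
  using norm_w_le order_trans by blast

lemma Im_w_sign:
  assumes "norm z \<le> 1" "Im z \<ge> 0"
  shows "side z \<ge> 0 \<Longrightarrow> Im (w z) \<ge> 0" "side z \<le> 0 \<Longrightarrow> Im (w z) \<le> 0"
proof -
  have N: "norm (1 + of_real a * z) ^ 2 > 0"
    using denom_nz[of z] assms by simp
  have eq: "Im (w z) * norm (1 + of_real a * z) ^ 2 = Im z * side z"
    using Im_w[of z] assms by simp
  show "Im (w z) \<ge> 0" if "side z \<ge> 0"
    using N eq that assms(2) by (metis mult_nonneg_nonneg zero_le_mult_iff not_less)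
  show "Im (w z) \<le> 0" if "side z \<le> 0"
    using N eq that assms(2) by (metis mult_nonneg_nonpos mult_le_0_iff not_less)
qed

lemma deriv_right_of_ray:
  assumes "norm z \<le> 1" "Im z \<ge> 0" "k * Re z + a * Im z \<ge> 0"
  shows "Im (phi (w z)) \<ge> 0" "Re (phi (w z)) + Im (phi (w z)) > 0"
  using phi_upper_disc(1,3)[OF norm_w_le_1 Im_w_sign(1)] right_of_ray assms by blast+

text \<open>On the right part the argument of \<open>\<phi> (w z)\<close> lies between \<open>- \<pi>/4\<close> and \<open>3\<pi>/4\<close>: where \<open>w z\<close> is in the
  upper half disc it is nonnegative, and the rest is the lens.\<close>

lemma deriv_right_part:
  assumes "norm z \<le> 1" "Im z \<ge> 0" "Re z \<ge> - a"
  shows "Re (phi (w z)) + Im (phi (w z)) > 0"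
proof (cases "side z \<ge> 0")
  case True
  then show ?thesis
    using phi_upper_disc(3)[OF norm_w_le_1 Im_w_sign(1)] assms by blast
next
  case False
  then have "- Im (phi (w z)) < Re (phi (w z))"
    using phi_lower_disc(3)[OF norm_w_le_1 Im_w_sign(2)] lens_bound[of z] assms by simp
  then show ?thesis by simp
qed

lemma deriv_left_part:
  assumes "norm z \<le> 1" "Im z \<ge> 0" "k * Re z + a * Im z \<le> 0"
  shows "Re (phi (w z)) - Im (phi (w z)) > 0"
proof (cases "side z \<le> 0")
  case True
  then show ?thesis
    using phi_lower_disc(2)[OF norm_w_le_1 Im_w_sign(2)] assms by blast
next
  case False
  then have "Im (phi (w z)) < Re (phi (w z))"
    using phi_upper_disc(4)[OF norm_w_le_1 Im_w_sign(1)] left_sector_bound[of z] assms by simp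
  then show ?thesis by simp
qed

definition T :: complex where
  "T = Complex (- a) k"

lemma T_simps [simp]: "Re T = - a" "Im T = k"
  by (simp_all add: T_def)

lemma norm_T [simp]: "norm T = 1"
  using ak by (simp add: cmod_def)

end

locale narrow_map = narrow_parameter +
  fixes f :: "complex \<Rightarrow> complex"
  assumes f_deriv: "\<And>z. norm z < 3/2 \<Longrightarrow> (f has_field_derivative phi (blaschke2 a z)) (at z)"
    and f_0: "f 0 = 0"
begin

abbreviation "f' z \<equiv> phi (w z)"

lemma f_cnj:
  assumes "norm z < 3/2"
  shows "f (cnj z) = cnj (f z)"
proof -
  define g where "g z = cnj (f (cnj z)) - f z" for z
  have "(g has_field_derivative 0) (at z within ball 0 (3/2))" if "z \<in> ball 0 (3/2)" for z
  proof -
    have "((cnj \<circ> f \<circ> cnj) has_field_derivative cnj (f' (cnj z))) (at z)"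
      by (rule has_field_derivative_cnj_cnj) (use that in \<open>auto intro: f_deriv\<close>)
    then have "((\<lambda>z. cnj (f (cnj z)) - f z) has_field_derivative cnj (f' (cnj z)) - f' z) (at z)"
      using that by (intro DERIV_diff f_deriv) (auto simp: o_def)
    then show ?thesis
      by (simp add: g_def[abs_def] blaschke2_cnj phi_cnj has_field_derivative_at_within)
  qed
  then obtain c where c: "\<And>z. z \<in> ball 0 (3/2) \<Longrightarrow> g z = c"
    using has_field_derivative_zero_constant[of "ball 0 (3/2)" g] by (auto simp: convex_ball)
  have "g z = g 0"
    using c[of z] c[of 0] assms by simp
  then have "cnj (f (cnj z)) = f z"
    by (simp add: g_def f_0)
  then show ?thesis
    by (metis complex_cnj_cnj)
qed

definition half :: "complex set" where
  "half = {z. norm z \<le> 1 \<and> Im z \<ge> 0}"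

lemma convex_half: "convex half"
proof -
  have "half = cball 0 1 \<inter> {z. Im z \<ge> 0}"
    by (auto simp: half_def)
  moreover have "convex (cball (0::complex) 1 \<inter> {z. Im z \<ge> 0})"
    by (intro convex_Int convex_cball convex_halfspace_Im_ge)
  ultimately show ?thesis
    by simp
qed

lemma convex_half_Int: "convex (half \<inter> {z. u * Re z + v * Im z \<le> c})"
proof -
  have "{z. u * Re z + v * Im z \<le> c} = {z. inner (Complex u v) z \<le> c}"
    by (simp add: inner_complex_def)
  then show ?thesis
    by (simp add: convex_Int convex_half convex_halfspace_le)
qed

definition "right_part = half \<inter> {z. Re z \<ge> - a}"
definition "left_part = half \<inter> {z. k * Re z + a * Im z \<le> 0}"
definition "right_sector = half \<inter> {z. k * Re z + a * Im z \<ge> 0}"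
definition "left_cap = half \<inter> {z. Re z \<le> - a}"

lemma convex_parts: "convex right_part" "convex left_part" "convex right_sector" "convex left_cap"
proof -
  have "{z. k * Re z + a * Im z \<ge> 0} = {z. - k * Re z + - a * Im z \<le> 0}"
      "{z. Re z \<ge> - a} = {z. - 1 * Re z + 0 * Im z \<le> a}" "{z. Re z \<le> - a} = {z. 1 * Re z + 0 * Im z \<le> - a}"
    by auto
  then show "convex right_part" "convex left_part" "convex right_sector" "convex left_cap"
    unfolding right_part_def left_part_def right_sector_def left_cap_def by (simp_all only: convex_half_Int)
qed

lemma f_deriv_half: "z \<in> half \<Longrightarrow> (f has_field_derivative f' z) (at z)"
  by (rule f_deriv) (simp add: half_def)

lemma inj_right_part: "inj_on f right_part"
proof (rule inj_on_convex_Re_deriv_pos[OF convex_parts(1), where c = "1 - \<i>"])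
  show "0 < Re ((1 - \<i>) * f' z)" if "z \<in> right_part" for z
    using deriv_right_part[of z] that by (simp add: right_part_def half_def)
qed (auto simp: right_part_def intro: f_deriv_half)

lemma inj_left_part: "inj_on f left_part"
proof (rule inj_on_convex_Re_deriv_pos[OF convex_parts(2), where c = "1 + \<i>"])
  show "0 < Re ((1 + \<i>) * f' z)" if "z \<in> left_part" for z
    using deriv_left_part[of z] that by (simp add: left_part_def half_def)
qed (auto simp: left_part_def intro: f_deriv_half)

end

section \<open>The separating functional on the unit circle\<close>

context narrow_parameter begin

text \<open>A Moebius image of the real line: it runs through the unit circle with \<open>arc 0 = T\<close>,
  \<open>arc 1 = - 1\<close> and \<open>arc (- 1) = 1\<close>.\<close>

definition arc :: "real \<Rightarrow> complex" where
  "arc s = (T - of_real s) / (1 - T * of_real s)"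

definition W :: "real \<Rightarrow> complex" where
  "W s = Complex (1 - s ^ 2) (2 * k * s)"

lemma arc_denom_nz: "1 - T * of_real s \<noteq> 0"
proof
  assume *: "1 - T * of_real s = 0"
  then have "k * s = 0"
    by (simp add: complex_eq_iff)
  then show False
    using * k_pos by simp
qed

lemma T_cnj: "T * cnj T = 1"
  using complex_norm_square[of T] by simp

lemma arc_0: "arc 0 = T"
  by (simp add: arc_def)

lemma norm_arc: "norm (arc s) = 1"
proof -
  have "T - of_real s = T * cnj (1 - T * of_real s)"
    using T_cnj by (simp add: algebra_simps)
  then have "norm (T - of_real s) = norm (1 - T * of_real s)"
    by (metis complex_mod_cnj norm_T norm_mult mult_1)
  then show ?thesis
    using arc_denom_nz by (simp add: arc_def norm_divide)
qed

lemma arc_surj: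
  assumes e: "norm e = 1" "Im e \<ge> 0"
  obtains s where "e = arc s" "\<bar>s\<bar> \<le> 1" "s * (a + Re e) \<le> 0"
proof
  define D where "D = 1 + a * Re e + k * Im e"
  define s where "s = - (a + Re e) / D"
  have x: "-1 \<le> Re e" "Re e \<le> 1"
    using abs_Re_le_cmod[of e] e by auto
  have kI: "k * Im e \<ge> 0"
    using e k_pos by simp
  have "a * Re e \<ge> a * (-1)"
    using x a_nonneg by (intro mult_left_mono) auto
  then have D: "D > 0"
    using a_bounds kI by (simp add: D_def)
  have sD: "s * D = - (a + Re e)"
    using D by (simp add: s_def)
  have e2: "Re e ^ 2 + Im e ^ 2 = 1"
    using e by (simp flip: cmod_power2)
  have "(k - Im e) * D = (- (a + Re e)) * (a * Im e - k * Re e)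
      + k * (1 - (Re e ^ 2 + Im e ^ 2)) + Im e * ((a ^ 2 + k ^ 2) - 1)"
    by (simp add: D_def power2_eq_square algebra_simps)
  also have "\<dots> = s * D * (a * Im e - k * Re e)"
    using e2 ak sD by simp
  finally have "(k - Im e) * D = (s * (a * Im e - k * Re e)) * D"
    by simp
  then have Im: "k - Im e = s * (a * Im e - k * Re e)"
    using D by simp
  have "T - e = of_real s * (1 - T * e)"
    using Im sD by (simp add: complex_eq_iff D_def algebra_simps)
  then have "T - of_real s = e * (1 - T * of_real s)"
    by (simp add: algebra_simps)
  then show "e = arc s"
    using arc_denom_nz by (simp add: arc_def)
  have "(1 + a) * (1 + Re e) \<ge> 0" "(1 - a) * (1 - Re e) \<ge> 0"
    using x a_nonneg a_bounds by (auto intro!: mult_nonneg_nonneg)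
  then have "\<bar>s * D\<bar> \<le> 1 * D"
    unfolding sD using kI by (simp add: D_def algebra_simps abs_le_iff)
  then show "\<bar>s\<bar> \<le> 1"
    using D by (simp add: abs_mult)
  show "s * (a + Re e) \<le> 0"
  proof -
    have "a + Re e = - (s * D)"
      using sD by simp
    then have "s * (a + Re e) = - (s ^ 2 * D)"
      by (simp add: power2_eq_square)
    then show ?thesis
      using D by simp
  qed
qed

lemma W_nz: "W s \<noteq> 0"
proof
  assume *: "W s = 0"
  then have "2 * k * s = 0"
    by (simp add: W_def complex_eq_iff)
  then show False
    using * k_pos by (simp add: W_def complex_eq_iff)
qed

text \<open>The factor \<open>1 - T s\<close> is common to numerator and denominator of \<open>w (arc s)\<close>; what remains is
  unimodular with numerator and denominator conjugate up to sign, because \<open>T W(s) = (1 + T s) (T - s)\<close>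
  and \<open>T cnj (W(s)) = (1 - T s) (T + s)\<close>.\<close>

lemma w_arc: "w (arc s) = - W s / cnj (W s)"
proof -
  define E where "E = 1 - T * of_real s"
  define S where "S = (of_real s :: complex)"
  have E: "E \<noteq> 0"
    using arc_denom_nz by (simp add: E_def)
  have T_nz: "T \<noteq> 0"
    using norm_T by (metis norm_zero zero_neq_one)
  have Tc: "T * cnj T = 1" "T * (T * cnj T) = T"
    using T_cnj by simp_all
  have a0: "2 * of_real a = - (T + cnj T)" and d: "T - cnj T = 2 * \<i> * of_real k"
    by (simp_all add: complex_eq_iff)
  have "T * (2 * of_real a) = - (T * T + T * cnj T)"
    unfolding a0 by (simp add: algebra_simps)
  then have a: "2 * T * of_real a = - (T * T + 1)"
    unfolding T_cnj by (simp add: mult_ac)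
  have T2: "T * T - 1 \<noteq> 0"
  proof
    assume "T * T - 1 = 0"
    then have "T * (T - cnj T) = 0"
      using T_cnj by (simp add: algebra_simps)
    then show False
      using T_nz d k_pos by simp
  qed
  have arc: "arc s * E = T - S"
    using E by (simp add: arc_def E_def S_def)
  have "2 * T * ((arc s + of_real a) * E) = 2 * T * (arc s * E) + (2 * T * of_real a) * E"
    by (simp add: algebra_simps)
  also have "\<dots> = (T * T - 1) * (1 + T * S)"
    unfolding arc a by (simp add: E_def S_def algebra_simps)
  finally have num: "2 * T * ((arc s + of_real a) * E) = (T * T - 1) * (1 + T * S)" .
  have "2 * T * ((1 + of_real a * arc s) * E) = 2 * T * E + (2 * T * of_real a) * (arc s * E)"
    by (simp add: algebra_simps)
  also have "\<dots> = - ((T * T - 1) * (T + S))"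
    unfolding arc a by (simp add: E_def S_def algebra_simps)
  finally have den: "2 * T * ((1 + of_real a * arc s) * E) = - ((T * T - 1) * (T + S))" .
  have W: "W s = 1 - S * S + S * (T - cnj T)" "cnj (W s) = 1 - S * S - S * (T - cnj T)"
    by (simp_all add: W_def S_def complex_eq_iff power2_eq_square)
  have W1: "T * W s = (1 + T * S) * (T - S)"
    unfolding W(1) using Tc by (simp add: algebra_simps)
  have W2: "T * cnj (W s) = E * (T + S)"
    unfolding W(2) using Tc by (simp add: E_def S_def algebra_simps)
  have TS: "T + S \<noteq> 0"
    using W2 W_nz[of s] T_nz by auto
  have "w (arc s) = arc s * (2 * T * ((arc s + of_real a) * E)) / (2 * T * ((1 + of_real a * arc s) * E))"
    using E T_nz by (simp add: blaschke2_def)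
  also have "\<dots> = - ((arc s * E) * (1 + T * S)) / (E * (T + S))"
    unfolding num den using T2 TS E by (simp add: divide_simps)
  also have "\<dots> = - (T * W s) / (T * cnj (W s))"
    unfolding arc W1 W2 by (simp add: mult_ac)
  also have "\<dots> = - W s / cnj (W s)"
    using T_nz by simp
  finally show ?thesis .
qed

lemma arc_deriv: "(arc has_vector_derivative (2 * \<i> * of_real k * T / (1 - T * of_real s) ^ 2)) (at s)"
proof -
  have T2: "T * T - 1 = 2 * \<i> * of_real k * T"
  proof -
    have "T * T - T * cnj T = 2 * \<i> * of_real k * T"
      by (simp add: complex_eq_iff algebra_simps)
    then show ?thesis
      by (simp add: T_cnj)
  qed
  have "((\<lambda>z. (T - z) / (1 - T * z)) has_field_derivative ((T * T - 1) / (1 - T * of_real s) ^ 2)) (at (of_real s))"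
    using arc_denom_nz[of s]
    by (auto intro!: derivative_eq_intros simp: power2_eq_square divide_simps) (simp add: algebra_simps)
  then have "(((\<lambda>z. (T - z) / (1 - T * z)) \<circ> of_real) has_vector_derivative 1 * ((T * T - 1) / (1 - T * of_real s) ^ 2)) (at s)"
    by (intro field_vector_diff_chain_at has_vector_derivative_of_real) (auto intro!: derivative_eq_intros)
  then show ?thesis
    unfolding T2 by (simp add: arc_def[abs_def] o_def)
qed

end

section \<open>Univalence of the extremal functions\<close>

context narrow_map begin

text \<open>The level lines of \<open>J\<close> are the preimages of lines parallel to the finger axis, whose direction is
  that of \<open>T\<close> because \<open>f'\<close> is positive at \<open>T\<close>; so the finger
  extends from its tip \<open>f T\<close> in the direction of the outward normal of the unit circle at \<open>T\<close>.\<close>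

definition J :: "complex \<Rightarrow> real" where
  "J z = Im (cnj T * f z)"

lemma J_deriv_arc:
  "((\<lambda>s. J (arc s)) has_real_derivative 2 * k * Re (phi (- W s / cnj (W s)) / (1 - T * of_real s) ^ 2)) (at s)"
proof -
  define d where "d = 2 * \<i> * of_real k * T / (1 - T * of_real s) ^ 2"
  have "(f \<circ> arc has_vector_derivative d * f' (arc s)) (at s)"
    unfolding d_def by (rule field_vector_diff_chain_at[OF arc_deriv]) (rule f_deriv, simp add: norm_arc)
  then have "((\<lambda>s. Im (cnj T * (f \<circ> arc) s)) has_vector_derivative Im (cnj T * (d * f' (arc s)))) (at s)"
    by (intro bounded_linear.has_vector_derivative[OF bounded_linear_Im] has_vector_derivative_mult_right)
  moreover define X where "X = f' (arc s) / (1 - T * of_real s) ^ 2"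
  have "cnj T * (d * f' (arc s)) = (T * cnj T) * (2 * of_real k * (\<i> * X))"
    by (simp add: d_def X_def)
  then have "Im (cnj T * (d * f' (arc s))) = Im (2 * of_real k * (\<i> * X))"
    unfolding T_cnj by (simp only: mult_1_left)
  then have "Im (cnj T * (d * f' (arc s))) = 2 * k * Re X"
    by simp
  ultimately show ?thesis
    unfolding X_def by (simp add: has_real_derivative_iff_has_vector_derivative J_def w_arc)
qed

lemma T_nz: "T \<noteq> 0"
  using norm_T by (metis norm_zero zero_neq_one)

lemma exit_point:
  assumes z: "norm z < 1"
  obtains s where "s > 0" "norm (z + of_real s * T) = 1"
proof -
  have "norm (z + of_real 2 * T) \<ge> norm (of_real 2 * T) - norm z"
    by (metis add.commute norm_diff_ineq)
  then have "norm (z + of_real 2 * T) \<ge> 1"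
    using z by (simp add: norm_mult)
  then have "\<exists>s\<ge>0. s \<le> 2 \<and> norm (z + of_real s * T) = 1"
    using z by (intro IVT') (auto intro!: continuous_intros)
  then obtain s where s: "s \<ge> 0" "norm (z + of_real s * T) = 1"
    by auto
  moreover have "s \<noteq> 0"
    using s(2) z by auto
  ultimately show ?thesis
    using that[of s] by simp
qed

text \<open>In direction \<open>T\<close> the derivative of \<open>J\<close> is \<open>Im f'\<close>, whose sign is that of \<open>side\<close>.\<close>

lemma J_mono_right:
  assumes "p \<in> right_sector" "q \<in> right_sector" "q = p + of_real s * T" "s \<ge> 0"
  shows "J p \<le> J q"
  unfolding J_def
proof (rule Im_directional_mono[OF convex_parts(3) assms(1,2)])
  show "(f has_field_derivative f' z) (at z)" if "z \<in> right_sector" for z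
    using that by (auto simp: right_sector_def intro: f_deriv_half)
  show "Im (cnj T * (q - p) * f' z) \<ge> 0" if "z \<in> right_sector" for z
  proof -
    have "cnj T * (q - p) * f' z = of_real s * (T * cnj T * f' z)"
      by (simp add: assms(3))
    then have "Im (cnj T * (q - p) * f' z) = s * Im (f' z)"
      unfolding T_cnj by (simp only: mult_1_left Im_complex_of_real Re_complex_of_real times_complex.simps mult_zero_left add_0_right)
    moreover have "Im (f' z) \<ge> 0"
      using deriv_right_of_ray(1)[of z] that by (simp add: right_sector_def half_def)
    ultimately show ?thesis
      using assms(4) by simp
  qed
qed

lemma J_strict_mono_left:
  assumes "p \<in> left_cap" "q \<in> left_cap" "q = p + of_real s * T" "s > 0" "Re p < - a" "Im p > 0"
  shows "J q < J p"
proof -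
  have "Im (- cnj T * f p) < Im (- cnj T * f q)"
  proof (rule Im_directional_strict_mono[OF convex_parts(4) assms(1,2)])
    show "p \<noteq> q"
      using assms(3,4) T_nz by auto
    show "(f has_field_derivative f' z) (at z)" if "z \<in> left_cap" for z
      using that by (auto simp: left_cap_def intro: f_deriv_half)
    show "Im (- cnj T * (q - p) * f' z) > 0" if z: "z \<in> open_segment p q" "z \<in> left_cap" for z
    proof -
      obtain t where t: "0 < t" "t < 1" "z = (1 - t) *\<^sub>R p + t *\<^sub>R q"
        using z(1) by (auto simp: in_segment)
      have z_eq: "z = p + of_real (t * s) * T"
        unfolding t(3) assms(3) by (simp add: scaleR_conv_of_real algebra_simps)
      have ts: "t * s > 0"
        using t assms(4) by simp
      have "t * s * a \<ge> 0" "t * s * k > 0"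
        using ts a_nonneg k_pos by simp_all
      moreover have "Re z = Re p - t * s * a" "Im z = Im p + t * s * k"
        by (simp_all add: z_eq)
      ultimately have "Re z < - a" "Im z > 0"
        using assms(5,6) by linarith+
      moreover have nz: "norm z \<le> 1"
        using z(2) by (simp add: left_cap_def half_def)
      ultimately have "side z < 0"
        using a_nonneg mult_left_mono[of "norm z ^ 2" 1 a] power_le_one[of "norm z" 2]
        by (simp add: side_def algebra_simps)
      then have "Im z * side z < 0"
        using \<open>Im z > 0\<close> by (simp add: mult_pos_neg)
      then have "Im (w z) * norm (1 + of_real a * z) ^ 2 < 0"
        using Im_w[of z] nz by simp
      then have "Im (cnj (w z)) > 0"
        by (simp add: mult_less_0_iff)
      then have "Im (phi (cnj (w z))) > 0"
        by (intro phi_upper_disc(2)) (use norm_w_le_1[OF nz] in auto)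
      then have "Im (f' z) < 0"
        by (simp add: phi_cnj)
      moreover have "- cnj T * (q - p) * f' z = of_real (- s) * (T * cnj T * f' z)"
        by (simp add: assms(3))
      then have "Im (- cnj T * (q - p) * f' z) = - s * Im (f' z)"
        unfolding T_cnj by (simp only: mult_1_left Im_complex_of_real Re_complex_of_real times_complex.simps mult_zero_left add_0_right)
      ultimately show ?thesis
        using assms(4) by (simp add: mult_pos_neg)
    qed
  qed
  then show ?thesis
    by (simp add: J_def)
qed

lemma left_cap_subset: "left_cap \<subseteq> left_part"
proof
  fix z assume z: "z \<in> left_cap"
  then have n: "norm z \<le> 1" "Im z \<ge> 0" "Re z \<le> - a"
    by (auto simp: left_cap_def half_def)
  have "norm z ^ 2 \<le> 1"
    using n(1) by (simp add: power_le_one)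
  moreover have "a ^ 2 \<le> (- Re z) ^ 2"
    using n(3) a_nonneg by (intro power_mono) auto
  ultimately have "(a * Im z) ^ 2 \<le> (k * - Re z) ^ 2"
    using mult_left_mono[of "norm z ^ 2" 1 "a ^ 2"]
    by (simp add: cmod_power2 power_mult_distrib k_sq algebra_simps)
  then have "a * Im z \<le> k * - Re z"
    by (rule power2_le_imp_le) (use n(3) k_pos a_nonneg in \<open>simp add: mult_nonneg_nonpos\<close>)
  then show "z \<in> left_part"
    using n by (simp add: left_part_def half_def)
qed

context
  assumes arc_left: "\<And>s. 0 \<le> s \<Longrightarrow> s \<le> 1 \<Longrightarrow> J T \<le> J (arc s)"
    and arc_right: "\<And>s. 0 \<le> s \<Longrightarrow> s \<le> 1 \<Longrightarrow> J (arc (- s)) \<le> J T"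
begin

lemma J_right:
  assumes z: "norm z < 1" "Im z \<ge> 0" "k * Re z + a * Im z > 0"
  shows "J z \<le> J T"
proof -
  obtain s where s: "s > 0" "norm (z + of_real s * T) = 1"
    using exit_point z by blast
  define e where "e = z + of_real s * T"
  have e: "norm e = 1" "Im e \<ge> 0" "k * Re e + a * Im e > 0"
    using z s k_pos by (simp_all add: e_def algebra_simps)
  have "J z \<le> J e"
    by (rule J_mono_right[of _ _ s]) (use z e s in \<open>auto simp: right_sector_def half_def e_def\<close>)
  also obtain r where r: "e = arc r" "\<bar>r\<bar> \<le> 1" "r * (a + Re e) \<le> 0"
    using arc_surj e by blast
  have "e \<notin> left_part"
    using e by (simp add: left_part_def)
  then have "a + Re e > 0"
    using left_cap_subset e by (force simp: left_cap_def half_def)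
  then have "r \<le> 0"
    using r(3) by (simp add: mult_le_0_iff)
  then have "J e \<le> J T"
    using arc_right[of "- r"] r by simp
  finally show ?thesis .
qed

lemma J_left:
  assumes z: "norm z < 1" "Im z > 0" "Re z < - a"
  shows "J z > J T"
proof -
  obtain s where s: "s > 0" "norm (z + of_real s * T) = 1"
    using exit_point z by blast
  define e where "e = z + of_real s * T"
  have "s * a \<ge> 0"
    using s a_nonneg by simp
  moreover have "Re e = Re z - s * a"
    by (simp add: e_def)
  ultimately have e: "norm e = 1" "Im e \<ge> 0" "Re e < - a"
    using z s k_pos by (simp_all add: e_def)
  obtain r where r: "e = arc r" "\<bar>r\<bar> \<le> 1" "r * (a + Re e) \<le> 0"
    using arc_surj e by blast
  have "r \<ge> 0"
    using r(3) e(3) by (simp add: mult_le_0_iff)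
  then have "J T \<le> J e"
    using arc_left[of r] r by simp
  also have "J e < J z"
    by (rule J_strict_mono_left[of _ _ s]) (use z e s in \<open>auto simp: left_cap_def half_def e_def\<close>)
  finally show ?thesis .
qed

text \<open>Points lying in no common convex part are on different sides of the separating line: one of them
  is to the left of the vertical line through \<open>T\<close>, the other to the right of the ray through \<open>T\<close>.\<close>

lemma inj_upper: "inj_on f {z. norm z < 1 \<and> Im z > 0}"
proof (rule inj_onI)
  fix u v assume uv: "u \<in> {z. norm z < 1 \<and> Im z > 0}" "v \<in> {z. norm z < 1 \<and> Im z > 0}" "f u = f v"
  have no: "\<not> (Re p < - a \<and> k * Re q + a * Im q > 0)"
    if "f p = f q" "norm p < 1" "Im p > 0" "norm q < 1" "Im q > 0" for p q
    using J_left[of p] J_right[of q] that by (auto simp: J_def)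
  \<comment> \<open>The instances with equal arguments say that \<open>Re p < - a\<close> already puts \<open>p\<close> to the left of the ray.\<close>
  consider "Re u \<ge> - a" "Re v \<ge> - a" | "k * Re u + a * Im u \<le> 0" "k * Re v + a * Im v \<le> 0"
    using no[of u v] no[of v u] no[of u u] no[of v v] uv by force
  then show "u = v"
  proof cases
    case 1
    then show ?thesis
      using uv by (intro inj_onD[OF inj_right_part uv(3)]) (auto simp: right_part_def half_def)
  next
    case 2
    then show ?thesis
      using uv by (intro inj_onD[OF inj_left_part uv(3)]) (auto simp: left_part_def half_def)
  qed
qed

end

lemma Im_increasing:
  assumes "convex S" "S \<subseteq> half" "p \<in> S" "q \<in> S" "q - p = of_real r * d" "r \<ge> 0"
    and "\<And>z. z \<in> S \<Longrightarrow> Im (d * f' z) > 0"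
  shows "Im (f p) \<le> Im (f q)" "r > 0 \<Longrightarrow> Im (f p) < Im (f q)"
proof -
  have *: "(f has_field_derivative f' z) (at z)" if "z \<in> S" for z
    using that assms(2) f_deriv_half by blast
  have eq: "Im (1 * (q - p) * f' z) = r * Im (d * f' z)" for z
    unfolding assms(5) by (simp add: algebra_simps)
  have "Im (1 * f p) \<le> Im (1 * f q)"
  proof (rule Im_directional_mono[OF assms(1,3,4) *])
    show "Im (1 * (q - p) * f' z) \<ge> 0" if "z \<in> S" for z
      unfolding eq using mult_nonneg_nonneg[OF assms(6) less_imp_le[OF assms(7)[OF that]]] .
  qed
  then show "Im (f p) \<le> Im (f q)"
    by simp
  show "Im (f p) < Im (f q)" if "r > 0"
  proof -
    have "d \<noteq> 0"
      using assms(7)[OF assms(3)] by auto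
    then have "p \<noteq> q"
      using assms(5) that by auto
    then have "Im (1 * f p) < Im (1 * f q)"
    proof (rule Im_directional_strict_mono[OF assms(1,3,4) _ *])
      show "Im (1 * (q - p) * f' z) > 0" if "z \<in> S" for z
        unfolding eq using assms(7) that \<open>r > 0\<close> by (intro mult_pos_pos)
    qed
    then show ?thesis
      by simp
  qed
qed

lemma Im_f_real: "Im z = 0 \<Longrightarrow> norm z < 3/2 \<Longrightarrow> Im (f z) = 0"
  using f_cnj[of z] by (metis complex_cnj_cancel_iff complex_eq_iff cnj.simps equal_neg_zero)

text \<open>The upper half disc is divided into four sectors with vertex 0, bounded by the real axis, the ray
  through \<open>T\<close> and the rays in the directions \<open>1 + i\<close> and \<open>- 1 + i\<close>. On the right of the ray through
  \<open>T\<close> the imaginary part of \<open>f\<close> increases in direction \<open>1 + i\<close>, on the left in direction \<open>- 1 + i\<close>.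
  So every point is reached from the real axis, or from the ray through \<open>T\<close>, along a path on which
  \<open>Im f\<close> increases; on that ray it increases from the value 0 at the origin.\<close>

lemma Im_f_pos:
  assumes z: "norm z < 1" "Im z > 0"
  shows "Im (f z) > 0"
proof -
  define x y where "x = Re z" and "y = Im z"
  have zxy: "z = Complex x y" and y: "y > 0" and n: "x ^ 2 + y ^ 2 < 1"
    using z by (simp_all add: x_def y_def complex_eq_iff flip: cmod_power2) (simp add: power_less_one_iff)
  have right: "Im ((1 + \<i>) * f' z) > 0" if "z \<in> right_sector" for z
    using deriv_right_of_ray[of z] that by (simp add: right_sector_def half_def)
  have left: "Im ((-1 + \<i>) * f' z) > 0" if "z \<in> left_part" for z
    using deriv_left_part[of z] that by (simp add: left_part_def half_def)
  have sub: "right_sector \<subseteq> half" "left_part \<subseteq> half"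
    by (auto simp: right_sector_def left_part_def)
  have real: "Im (f (of_real r)) = 0" if "\<bar>r\<bar> \<le> 1" for r
    using that by (intro Im_f_real) auto
  have ray: "Im (f (of_real r * T)) > 0" if r: "0 < r" "r \<le> 1" for r
  proof -
    have mem: "0 \<in> right_sector \<inter> left_part" "of_real r * T \<in> right_sector \<inter> left_part"
      using r k_pos by (auto simp: right_sector_def left_part_def half_def norm_mult algebra_simps)
    have T_pos: "Im (T * f' z) > 0" if "z \<in> right_sector \<inter> left_part" for z
    proof -
      have v: "Im (f' z) \<ge> 0" "Im (f' z) < Re (f' z)"
        using deriv_right_of_ray(1)[of z] deriv_left_part[of z] that
        by (simp_all add: right_sector_def left_part_def half_def)
      have "a * Im (f' z) \<le> k * Im (f' z)"
        using v a_bounds by (intro mult_right_mono)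
      also have "\<dots> < k * Re (f' z)"
        using v k_pos by simp
      finally show ?thesis by simp
    qed
    have "Im (f 0) < Im (f (of_real r * T))"
      by (rule Im_increasing(2)[OF _ _ mem _ _ T_pos, of r])
        (use r sub convex_parts in \<open>auto intro: convex_Int\<close>)
    then show ?thesis
      by (simp add: f_0)
  qed
  show ?thesis
  proof (cases "k * x + a * y \<ge> 0")
    case True
    have zr: "z \<in> right_sector"
      using True z by (simp add: right_sector_def half_def x_def y_def)
    show ?thesis
    proof (cases "x \<ge> y")
      case True
      have "x ^ 2 < 1"
        using n by (smt (verit) zero_le_power2)
      then have "x < 1"
        using y True by (simp add: power_less_one_iff abs_square_less_1)
      then have mem: "of_real (x - y) \<in> right_sector"
        using True y k_pos by (auto simp: right_sector_def half_def simp del: of_real_diff)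
      have "Im (f (of_real (x - y))) < Im (f z)"
        by (rule Im_increasing(2)[OF convex_parts(3) sub(1) mem zr _ _ right, of y])
          (use y in \<open>auto simp: zxy complex_eq_iff\<close>)
      then show ?thesis
        using real[of "x - y"] True y \<open>x < 1\<close> by simp
    next
      case False
      define r where "r = (y - x) / (k + a)"
      define b where "b = (k * x + a * y) / (k + a)"
      have ka: "k + a > 0"
        using k_pos a_nonneg by simp
      have r: "r > 0" and b: "b \<ge> 0"
        using False ka \<open>k * x + a * y \<ge> 0\<close> by (simp_all add: r_def b_def)
      have rb: "r * (k + a) = y - x" "b * (k + a) = k * x + a * y"
        using ka by (simp_all add: r_def b_def)
      have "(- a * r + b) * (k + a) = - a * (r * (k + a)) + b * (k + a)"
          "(k * r + b) * (k + a) = k * (r * (k + a)) + b * (k + a)"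
        by (simp_all add: algebra_simps)
      then have "(- a * r + b) * (k + a) = x * (k + a)" "(k * r + b) * (k + a) = y * (k + a)"
        unfolding rb by (simp_all add: algebra_simps)
      then have xy: "x = - a * r + b" "y = k * r + b"
        using ka by simp_all
      have "r ^ 2 \<le> r ^ 2 * (a ^ 2 + k ^ 2) + 2 * (r * b * (k - a)) + 2 * b ^ 2"
        using r b a_bounds ak by (simp add: mult_nonneg_nonneg)
      also have "\<dots> = x ^ 2 + y ^ 2"
        unfolding xy by (simp add: power2_eq_square algebra_simps)
      finally have "r ^ 2 \<le> 1 ^ 2"
        using n by simp
      then have r1: "r \<le> 1"
        by (rule power2_le_imp_le) simp
      have mem: "of_real r * T \<in> right_sector"
        using r r1 k_pos by (auto simp: right_sector_def half_def norm_mult algebra_simps)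
      have "Im (f (of_real r * T)) \<le> Im (f z)"
        by (rule Im_increasing(1)[OF convex_parts(3) sub(1) mem zr _ _ right, of b])
          (use b in \<open>auto simp: zxy complex_eq_iff xy\<close>)
      then show ?thesis
        using ray[OF r r1] by simp
    qed
  next
    case False
    have zl: "z \<in> left_part"
      using False z by (simp add: left_part_def half_def x_def y_def)
    show ?thesis
    proof (cases "x + y \<le> 0")
      case True
      have "x ^ 2 < 1"
        using n by (smt (verit) zero_le_power2)
      then have "- 1 < x"
        by (simp add: abs_square_less_1)
      then have mem: "of_real (x + y) \<in> left_part"
        using True y k_pos by (auto simp: left_part_def half_def mult_nonneg_nonpos simp del: of_real_add)
      have "Im (f (of_real (x + y))) < Im (f z)"
        by (rule Im_increasing(2)[OF convex_parts(2) sub(2) mem zl _ _ left, of y])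
          (use y in \<open>auto simp: zxy complex_eq_iff\<close>)
      then show ?thesis
        using real[of "x + y"] True y \<open>- 1 < x\<close> by simp
    next
      case False
      have "a ^ 2 < k ^ 2"
        using a_le by (simp add: k_sq)
      then have ka: "k - a > 0"
        using power2_less_imp_less[of a k] k_pos by simp
      define r where "r = (x + y) / (k - a)"
      define b where "b = - (k * x + a * y) / (k - a)"
      have r: "r > 0" and b: "b \<ge> 0"
        using False ka \<open>\<not> k * x + a * y \<ge> 0\<close> by (simp_all add: r_def b_def divide_nonpos_pos)
      have rb: "r * (k - a) = x + y" "b * (k - a) = - (k * x + a * y)"
        using ka by (simp_all add: r_def b_def)
      have "(- a * r - b) * (k - a) = - a * (r * (k - a)) - b * (k - a)"
          "(k * r + b) * (k - a) = k * (r * (k - a)) + b * (k - a)"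
        by (simp_all add: algebra_simps)
      then have "(- a * r - b) * (k - a) = x * (k - a)" "(k * r + b) * (k - a) = y * (k - a)"
        unfolding rb by (simp_all add: algebra_simps)
      then have xy: "x = - a * r - b" "y = k * r + b"
        using ka by simp_all
      have "r ^ 2 \<le> r ^ 2 * (a ^ 2 + k ^ 2) + 2 * (r * b * (k + a)) + 2 * b ^ 2"
        using r b a_nonneg k_pos ak by (simp add: mult_nonneg_nonneg)
      also have "\<dots> = x ^ 2 + y ^ 2"
        unfolding xy by (simp add: power2_eq_square algebra_simps)
      finally have "r ^ 2 \<le> 1 ^ 2"
        using n by simp
      then have r1: "r \<le> 1"
        by (rule power2_le_imp_le) simp
      have mem: "of_real r * T \<in> left_part"
        using r r1 k_pos by (auto simp: left_part_def half_def norm_mult algebra_simps)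
      have "Im (f (of_real r * T)) \<le> Im (f z)"
        by (rule Im_increasing(1)[OF convex_parts(2) sub(2) mem zl _ _ left, of b])
          (use b in \<open>auto simp: zxy complex_eq_iff xy\<close>)
      then show ?thesis
        using ray[OF r r1] by simp
    qed
  qed
qed

lemma inj_real: "inj_on f {z. norm z < 1 \<and> Im z = 0}"
proof (rule inj_on_convex_Re_deriv_pos[where c = 1])
  have "{z. norm z < 1 \<and> Im z = 0} = ball 0 1 \<inter> {z. inner \<i> z = 0}"
    by (auto simp: inner_complex_def)
  then show "convex {z. norm z < 1 \<and> Im z = 0}"
    by (simp only: convex_Int convex_ball convex_hyperplane)
  show "0 < Re (1 * f' z)" if "z \<in> {z. norm z < 1 \<and> Im z = 0}" for z
  proof -
    have z: "norm z \<le> 1" "Im z = 0"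
      using that by auto
    have "Im (w z) * norm (1 + of_real a * z) ^ 2 = 0"
      using Im_w[of z] z by simp
    then have "Im (w z) = 0"
      using denom_nz[of z] z by simp
    then show ?thesis
      using phi_upper_disc(3)[OF norm_w_le_1[OF z(1)]] phi_lower_disc(1)[OF norm_w_le_1[OF z(1)]] by fastforce
  qed
qed (auto intro: f_deriv)

theorem inj_disc:
  assumes "\<And>s. 0 \<le> s \<Longrightarrow> s \<le> 1 \<Longrightarrow> J T \<le> J (arc s)"
    and "\<And>s. 0 \<le> s \<Longrightarrow> s \<le> 1 \<Longrightarrow> J (arc (- s)) \<le> J T"
  shows "inj_on f (ball 0 1)"
proof (rule inj_onI)
  fix u v assume "u \<in> ball 0 1" "v \<in> ball 0 1" and eq: "f u = f v"
  then have uv: "norm u < 1" "norm v < 1"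
    by auto
  note upper = inj_upper[OF assms]
  have neg: "Im (f z) < 0" if "norm z < 1" "Im z < 0" for z
    using Im_f_pos[of "cnj z"] that f_cnj[of z] by simp
  have sgn: "sgn (Im (f z)) = sgn (Im z)" if "norm z < 1" for z
    using that Im_f_pos[of z] neg[of z] Im_f_real[of z] by (cases "Im z" "0 :: real" rule: linorder_cases) auto
  have "sgn (Im u) = sgn (Im v)"
    using sgn[OF uv(1)] sgn[OF uv(2)] eq by simp
  then consider "Im u > 0" "Im v > 0" | "Im u = 0" "Im v = 0" | "Im u < 0" "Im v < 0"
    by (auto simp: sgn_if split: if_splits)
  then show "u = v"
  proof cases
    case 1
    then show ?thesis
      using uv by (intro inj_onD[OF upper eq]) auto
  next
    case 2
    then show ?thesis
      using uv by (intro inj_onD[OF inj_real eq]) auto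
  next
    case 3
    have "f (cnj u) = f (cnj v)"
      using uv eq f_cnj[of u] f_cnj[of v] by simp
    moreover have "cnj u \<in> {z. norm z < 1 \<and> Im z > 0}" "cnj v \<in> {z. norm z < 1 \<and> Im z > 0}"
      using uv 3 by simp_all
    ultimately have "cnj u = cnj v"
      using upper unfolding inj_on_def by blast
    then show ?thesis
      by simp
  qed
qed

end

section \<open>From integer polynomials to the speed along the circle\<close>

text \<open>Horner's scheme for \<open>\<Sum> c\<^sub>j Z\<^sup>j N\<^bsup>n - j\<^esup>\<close>, the homogenized polynomial in \<open>Z / N\<close>, with a complex
  polynomial \<open>Z\<close> represented by its real and imaginary parts.\<close>

fun hom_horner :: "int list \<Rightarrow> int list \<Rightarrow> int list \<Rightarrow> int list \<Rightarrow> int list \<times> int list" where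
  "hom_horner Zr Zi N [] = ([], [])"
| "hom_horner Zr Zi N (c # cs) = (let (a, b) = hom_horner Zr Zi N cs in
     (ip_add (ip_scale c (ip_power N (length cs))) (ip_add (ip_mult Zr a) (ip_scale (-1) (ip_mult Zi b))),
      ip_add (ip_mult Zr b) (ip_mult Zi a)))"

text \<open>The coefficients of \<open>720 \<phi>(- z)\<close> up to degree seven; the sign accounts for \<open>w (arc s) = - W(s) / cnj (W(s))\<close>.\<close>

definition phi_coeffs :: "int list" where
  "phi_coeffs = [720, -1440, 1080, -360, 30, 18, -7, 1]"

text \<open>If \<open>z = U + i V\<close> and \<open>N = \<bar>z\<bar>\<^sup>2\<close>, this is \<open>720 N\<^sup>7 (Re ((A + i B) * P) - C)\<close>, where \<open>P\<close> is the
  Taylor polynomial of \<open>\<phi>\<close> at \<open>- z / cnj z\<close>.\<close>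

definition margin_poly :: "int list \<Rightarrow> int list \<Rightarrow> int list \<Rightarrow> int list \<Rightarrow> int list \<Rightarrow> int list" where
  "margin_poly U V A B C = (let
     U2 = ip_mult U U; V2 = ip_mult V V; N = ip_add U2 V2;
     S = hom_horner (ip_add U2 (ip_scale (-1) V2)) (ip_scale 2 (ip_mult U V)) N phi_coeffs
     in ip_add (ip_mult A (fst S)) (ip_add (ip_scale (-1) (ip_mult B (snd S)))
          (ip_scale (-720) (ip_mult C (ip_power N 7)))))"

text \<open>The case \<open>a = 0\<close>, where \<open>T = i\<close> and \<open>s = x\<close>: here \<open>A + i B\<close> is \<open>10\<^sup>5 (1 + i x)\<^sup>2\<close>, and \<open>C\<close> is the
  corresponding multiple of the right-hand side \<open>m / 2000 + \<rho> m\<^sup>2\<close> with \<open>m = 1 + x\<^sup>2\<close> and \<open>r = 100 \<rho>\<close>.\<close>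

definition margin_sq :: "int list \<Rightarrow> int list" where
  "margin_sq r = margin_poly [1, 0, -1] [0, 2] [100000, 0, -100000] [0, 200000]
     (ip_add [50, 0, 50] (ip_mult r [1000, 0, 2000, 0, 1000]))"

text \<open>The case \<open>a\<^sup>2 = 2/5\<close> with \<open>s = \<sigma> k (13/10) x\<close>, where \<open>13/10\<close> is slightly larger than \<open>1/k\<close> and
  \<open>r = 1000 \<rho>\<close>. The only irrational quantity left is \<open>a k\<close>, which is replaced by \<open>P / 10\<^sup>4\<close>; powers
  of \<open>a k\<close> beyond the first have been eliminated by \<open>(a k)\<^sup>2 = 6/25\<close>, so that the dependence on \<open>P\<close> is affine.
  All coefficients carry a factor \<open>10\<^bsup>11\<^esup>\<close>, and \<open>U + i V\<close> is \<open>500 W(s)\<close>.\<close>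

definition margin_ext :: "int \<Rightarrow> int \<Rightarrow> int list \<Rightarrow> int list" where
  "margin_ext \<sigma> P r = margin_poly [500, 0, -507] [0, 780 * \<sigma>]
     [100000000000, 26000000 * \<sigma> * P, -20280000000] [0, 156000000000 * \<sigma>, 20280000 * P]
     (ip_add [50000000, 13000 * \<sigma> * P, 50700000]
       (ip_mult r [100000000, 52000 * \<sigma> * P, 365040000, 52728 * \<sigma> * P, 102819600]))"

fun cx_poly :: "int list \<Rightarrow> complex \<Rightarrow> complex" where
  "cx_poly [] z = 0"
| "cx_poly (c # cs) z = of_int c + z * cx_poly cs z"

lemma hom_horner_eval:
  assumes Z: "Z = Complex (ip_eval Zr x) (ip_eval Zi x)" and N: "ip_eval N x \<noteq> 0"
  shows "of_real (ip_eval N x) * Complex (ip_eval (fst (hom_horner Zr Zi N cs)) x) (ip_eval (snd (hom_horner Zr Zi N cs)) x)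
    = of_real (ip_eval N x) ^ length cs * cx_poly cs (Z / of_real (ip_eval N x))"
proof (induction cs)
  case (Cons c cs)
  obtain p q where pq: "hom_horner Zr Zi N cs = (p, q)"
    by fastforce
  define n where "n = (of_real (ip_eval N x) :: complex)"
  define H where "H = Complex (ip_eval p x) (ip_eval q x)"
  have IH: "n * H = n ^ length cs * cx_poly cs (Z / n)"
    using Cons by (simp add: pq n_def H_def)
  have n: "n \<noteq> 0"
    using N by (simp add: n_def)
  have "Complex (ip_eval (fst (hom_horner Zr Zi N (c # cs))) x) (ip_eval (snd (hom_horner Zr Zi N (c # cs))) x)
      = of_int c * n ^ length cs + Z * H"
    by (simp add: pq n_def H_def Z complex_eq_iff Re_power_real flip: of_real_power)
  also have "n * \<dots> = of_int c * n ^ Suc (length cs) + Z * (n * H)"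
    by (simp add: algebra_simps)
  also have "\<dots> = n ^ length (c # cs) * cx_poly (c # cs) (Z / n)"
    unfolding IH using n by (simp add: field_simps)
  finally show ?case
    by (simp add: n_def)
qed (simp add: complex_eq_iff)

lemma cx_poly_phi_coeffs: "cx_poly phi_coeffs (- z) = 720 * phi_taylor z"
  by (simp add: phi_coeffs_def phi_taylor_def eval_nat_numeral algebra_simps)

lemma margin_poly_sound:
  assumes "ip_eval (margin_poly U V A B C) x \<ge> 0"
    and z: "z = Complex (ip_eval U x) (ip_eval V x)" "z \<noteq> 0"
  shows "ip_eval A x * Re (phi_taylor (- z / cnj z)) - ip_eval B x * Im (phi_taylor (- z / cnj z)) \<ge> ip_eval C x"
proof -
  define U2 V2 where "U2 = ip_mult U U" and "V2 = ip_mult V V"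
  define N where "N = ip_add U2 V2"
  define Zr Zi where "Zr = ip_add U2 (ip_scale (- 1) V2)" and "Zi = ip_scale 2 (ip_mult U V)"
  define S where "S = hom_horner Zr Zi N phi_coeffs"
  define n where "n = ip_eval N x"
  have zz: "z * cnj z = of_real n"
    by (simp add: z n_def N_def U2_def V2_def complex_eq_iff power2_eq_square)
  have "n = norm z ^ 2"
    using zz by (simp flip: complex_norm_square of_real_eq_iff[where 'a = complex])
  then have n: "n > 0"
    using z(2) by simp
  have Z: "z ^ 2 = Complex (ip_eval Zr x) (ip_eval Zi x)"
    by (simp add: z(1) Zr_def Zi_def U2_def V2_def complex_eq_iff power2_eq_square)
  have "z ^ 2 / of_real n = z / cnj z"
    unfolding zz[symmetric] using z(2) by (simp add: power2_eq_square)
  then have quot: "z ^ 2 / of_real n = - (- z / cnj z)"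
    by simp
  have "of_real n * Complex (ip_eval (fst S) x) (ip_eval (snd S) x)
      = of_real n ^ length phi_coeffs * cx_poly phi_coeffs (z ^ 2 / of_real n)"
    unfolding S_def n_def using n by (intro hom_horner_eval[OF Z]) (simp add: n_def)
  also have "\<dots> = of_real n * (of_real (720 * n ^ 7) * phi_taylor (- z / cnj z))"
    unfolding quot cx_poly_phi_coeffs by (simp add: phi_coeffs_def eval_nat_numeral)
  finally have "Complex (ip_eval (fst S) x) (ip_eval (snd S) x) = of_real (720 * n ^ 7) * phi_taylor (- z / cnj z)"
    using n by simp
  then have "ip_eval (fst S) x = 720 * n ^ 7 * Re (phi_taylor (- z / cnj z))"
      "ip_eval (snd S) x = 720 * n ^ 7 * Im (phi_taylor (- z / cnj z))"
    unfolding complex_eq_iff by (simp_all only: complex.sel Re_complex_of_real Im_complex_of_real times_complex.simps mult_zero_left diff_zero add_0_right)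
  moreover have "ip_eval (margin_poly U V A B C) x
      = ip_eval A x * ip_eval (fst S) x - ip_eval B x * ip_eval (snd S) x - 720 * ip_eval C x * n ^ 7"
    by (simp add: margin_poly_def Let_def n_def N_def S_def Zr_def Zi_def U2_def V2_def algebra_simps)
  ultimately have "0 \<le> 720 * n ^ 7 * (ip_eval A x * Re (phi_taylor (- z / cnj z))
      - ip_eval B x * Im (phi_taylor (- z / cnj z)) - ip_eval C x)"
    using assms(1) by (simp add: algebra_simps)
  then show ?thesis
    using n by (simp add: zero_le_mult_iff)
qed

lemma affine_nonneg_between:
  fixes \<alpha> :: real
  assumes "\<alpha> + \<beta> * l \<ge> 0" "\<alpha> + \<beta> * u \<ge> 0" "l \<le> p" "p \<le> u"
  shows "\<alpha> + \<beta> * p \<ge> 0"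
proof (cases "\<beta> \<ge> 0")
  case True
  then show ?thesis
    using mult_left_mono[OF assms(3), of \<beta>] assms(1) by linarith
next
  case False
  then show ?thesis
    using mult_left_mono_neg[OF assms(4), of \<beta>] assms(2) by linarith
qed

context narrow_parameter begin

text \<open>The derivative of \<open>J\<close> along \<open>arc\<close>, divided by \<open>2 k\<close>.\<close>

definition arc_speed :: "real \<Rightarrow> real" where
  "arc_speed s = Re (phi (- W s / cnj (W s)) / (1 - T * of_real s) ^ 2)"

text \<open>The term \<open>m / 2000\<close> absorbs the Taylor error; multiplying by the squared norm of the denominator
  makes the inequality polynomial.\<close>

lemma arc_speed_ge:
  fixes s :: real
  defines "m \<equiv> 1 + 2 * a * s + s ^ 2"
  assumes "Re ((1 - cnj T * of_real s) ^ 2 * phi_taylor (- W s / cnj (W s))) \<ge> m / 2000 + \<rho> * m ^ 2"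
  shows "arc_speed s \<ge> \<rho>"
proof -
  define v where "v = - W s / cnj (W s)"
  define D where "D = 1 - T * of_real s"
  have D_nz: "D \<noteq> 0"
    using arc_denom_nz by (simp add: D_def)
  have m: "m = norm D ^ 2"
  proof -
    have "norm D ^ 2 = 1 + 2 * a * s + (a ^ 2 + k ^ 2) * s ^ 2"
      unfolding D_def cmod_power2 by (simp add: power2_eq_square algebra_simps)
    then show ?thesis
      unfolding ak m_def by simp
  qed
  have m_pos: "m > 0"
    using D_nz by (simp add: m)
  have cD: "cnj D = 1 - cnj T * of_real s"
    by (simp add: D_def)
  have nv: "norm v \<le> 1"
    using W_nz by (simp add: v_def norm_divide)
  have "Re (cnj D ^ 2 * phi v) = Re (cnj D ^ 2 * phi_taylor v) + Re (cnj D ^ 2 * (phi v - phi_taylor v))"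
    by (simp add: right_diff_distrib flip: plus_complex.simps)
  moreover have "\<bar>Re (cnj D ^ 2 * (phi v - phi_taylor v))\<bar> \<le> m * (1 / 2000)"
  proof -
    have "norm (cnj D ^ 2 * (phi v - phi_taylor v)) \<le> m * (1 / 2000)"
      unfolding norm_mult norm_power complex_mod_cnj m by (intro mult_left_mono phi_taylor_error nv) simp
    then show ?thesis
      using abs_Re_le_cmod order_trans by blast
  qed
  ultimately have "Re (cnj D ^ 2 * phi v) \<ge> \<rho> * m ^ 2"
    using assms(2) unfolding cD v_def by linarith
  moreover have "phi v / D ^ 2 = cnj D ^ 2 * phi v / of_real (m ^ 2)"
  proof -
    have "of_real (m ^ 2) = (D * cnj D) ^ 2"
      unfolding m of_real_power complex_norm_square[symmetric] by simp
    then show ?thesis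
      using D_nz by (simp add: power_mult_distrib)
  qed
  then have "arc_speed s = Re (cnj D ^ 2 * phi v) / m ^ 2"
    unfolding arc_speed_def v_def[symmetric] D_def[symmetric] by (simp only: Re_divide_of_real)
  ultimately show ?thesis
    using m_pos by (simp add: le_divide_eq)
qed

end

text \<open>The last argument is the minorant of the speed along the circle. It has been fitted so that it stays
  below the speed and has a nonnegative primitive; the speed itself becomes negative on part of the
  circle, where the boundary of the finger turns back towards its axis.\<close>

lemma nonneg_cert_square:
  "nonneg_cert 1 (margin_sq [4, 60, -1050, 3400, -2450])"
  by code_simp+

lemma nonneg_cert_left:
  "nonneg_cert 2 (margin_ext 1 4898 [45, 300, -5000, 12600, -7200])"
  "nonneg_cert 2 (margin_ext 1 4900 [45, 300, -5000, 12600, -7200])"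
  by code_simp+

lemma nonneg_cert_right:
  "nonneg_cert 1 (margin_ext (-1) 4898 [50, 0, 2000, -41000, 137000, -107000])"
  "nonneg_cert 1 (margin_ext (-1) 4900 [50, 0, 2000, -41000, 137000, -107000])"
  by code_simp+

text \<open>The primitives of the three minorants, divided by \<open>x\<close> and scaled to integral coefficients.\<close>

lemma nonneg_cert_integrals:
  "nonneg_cert 3 [12*45, 6*300, -4*5000, 3*12600, -12*1440]"
  "nonneg_cert 3 [60*4, 30*60, -20*1050, 15*3400, -12*2450]"
  "nonneg_cert 3 [60*50, 0, 20*2000, -15*41000, 12*137000, -10*107000]"
  by code_simp+

context narrow_map begin

text \<open>Integrating a lower bound for the speed; the sign \<open>\<sigma>\<close> selects the arc to the left or to the right
  of \<open>T\<close>.\<close>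

lemma J_arc_bound:
  assumes \<sigma>: "\<sigma> = 1 \<or> \<sigma> = -1" and X: "X > 0" "k * X \<ge> 1"
    and speed: "\<And>x. 0 \<le> x \<Longrightarrow> x \<le> 1 \<Longrightarrow> arc_speed (\<sigma> * (k * X * x)) \<ge> \<rho> x"
    and prim: "\<And>x. (P has_real_derivative \<rho> x) (at x)" "P 0 = 0"
    and P: "\<And>x. 0 \<le> x \<Longrightarrow> x \<le> 1 \<Longrightarrow> P x \<ge> 0"
    and s: "0 \<le> s" "s \<le> 1"
  shows "\<sigma> * J T \<le> \<sigma> * J (arc (\<sigma> * s))"
proof -
  define x where "x = s / (k * X)"
  have kX: "k * X > 0"
    using X k_pos by simp
  have x: "0 \<le> x" "x \<le> 1"
    using s kX X by (simp_all add: x_def divide_le_eq)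
  have sx: "s = k * X * x"
    using k_pos X(1) by (simp add: x_def)
  define G where "G y = \<sigma> * J (arc (\<sigma> * (k * X * y))) - 2 * k ^ 2 * X * P y" for y
  have "(G has_real_derivative (2 * k ^ 2 * X * (arc_speed (\<sigma> * (k * X * y)) - \<rho> y))) (at y)" for y
  proof -
    have "((\<lambda>y. J (arc (\<sigma> * (k * X * y)))) has_real_derivative 2 * k * arc_speed (\<sigma> * (k * X * y)) * (\<sigma> * (k * X))) (at y)"
      by (rule DERIV_chain2[OF J_deriv_arc[folded arc_speed_def]]) (auto intro!: derivative_eq_intros)
    then have "(G has_real_derivative (\<sigma> * (2 * k * arc_speed (\<sigma> * (k * X * y)) * (\<sigma> * (k * X))) - 2 * k ^ 2 * X * \<rho> y)) (at y)"
      unfolding G_def by (intro DERIV_diff DERIV_cmult prim)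
    moreover have "\<sigma> * (2 * k * u * (\<sigma> * (k * X))) - 2 * k ^ 2 * X * \<rho> y = 2 * k ^ 2 * X * (u - \<rho> y)" for u
      using \<sigma> by (auto simp: power2_eq_square algebra_simps)
    ultimately show ?thesis
      by simp
  qed
  note G_deriv = this
  have "G 0 \<le> G x"
  proof (rule DERIV_nonneg_imp_nondecreasing[OF x(1)])
    fix y assume y: "0 \<le> y" "y \<le> x"
    have "arc_speed (\<sigma> * (k * X * y)) - \<rho> y \<ge> 0"
      using speed[of y] x y by simp
    then have "2 * k ^ 2 * X * (arc_speed (\<sigma> * (k * X * y)) - \<rho> y) \<ge> 0"
      using X(1) by (intro mult_nonneg_nonneg) auto
    then show "\<exists>d. (G has_real_derivative d) (at y) \<and> 0 \<le> d"
      using G_deriv by blast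
  qed
  moreover have "2 * k ^ 2 * X * P x \<ge> 0"
    using P[OF x] X by simp
  moreover have "G 0 = \<sigma> * J T" "G x = \<sigma> * J (arc (\<sigma> * s)) - 2 * k ^ 2 * X * P x"
    by (simp_all add: G_def prim(2) arc_0 sx)
  ultimately show ?thesis
    by linarith
qed

end

text \<open>For \<open>a = 0\<close> the speed is an even function, so one certificate serves both arcs.\<close>

lemma arc_bound_square:
  assumes "narrow_map 0 1 f" "\<sigma> = 1 \<or> \<sigma> = -1" "0 \<le> s" "s \<le> 1"
  shows "\<sigma> * narrow_map.J 0 1 f (narrow_parameter.T 0 1) \<le> \<sigma> * narrow_map.J 0 1 f (narrow_parameter.arc 0 1 (\<sigma> * s))"
proof -
  interpret narrow_map 0 1 f by fact
  define r where "r = [4, 60, -1050, 3400, -2450 :: int]"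
  have pos: "arc_speed x \<ge> ip_eval r x / 100" if x: "0 \<le> x" "x \<le> 1" for x
  proof (rule arc_speed_ge)
    define D where "D = (1 - cnj T * of_real x) ^ 2"
    have "ip_eval (margin_sq r) x \<ge> 0"
      using nonneg_cert_sound[OF nonneg_cert_square x] by (simp add: r_def)
    moreover have "W x = Complex (ip_eval [1, 0, -1] x) (ip_eval [0, 2] x)"
      by (simp add: W_def power2_eq_square)
    ultimately have *: "ip_eval [100000, 0, -100000] x * Re (phi_taylor (- W x / cnj (W x)))
        - ip_eval [0, 200000] x * Im (phi_taylor (- W x / cnj (W x)))
        \<ge> ip_eval (ip_add [50, 0, 50] (ip_mult r [1000, 0, 2000, 0, 1000])) x"
      unfolding margin_sq_def using W_nz by (intro margin_poly_sound)
    have scale: "u \<le> b - c" if "100000 * u \<le> 100000 * b - 100000 * c" for u b c :: real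
      using that by simp
    have AB: "ip_eval [100000, 0, -100000] x = 100000 * Re D" "ip_eval [0, 200000] x = 100000 * Im D"
      by (simp_all add: D_def power2_eq_square)
    have C: "ip_eval (ip_add [50, 0, 50] (ip_mult r [1000, 0, 2000, 0, 1000])) x
        = 100000 * ((1 + 2 * 0 * x + x ^ 2) / 2000 + ip_eval r x / 100 * (1 + 2 * 0 * x + x ^ 2) ^ 2)"
      unfolding ip_eval_add ip_eval_mult by (simp add: power2_eq_square field_simps)
    show "(1 + 2 * 0 * x + x ^ 2) / 2000 + ip_eval r x / 100 * (1 + 2 * 0 * x + x ^ 2) ^ 2
        \<le> Re ((1 - cnj T * of_real x) ^ 2 * phi_taylor (- W x / cnj (W x)))"
      unfolding D_def[symmetric] times_complex.simps
      by (rule scale) (rule *[unfolded AB C mult.assoc[of 100000]])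
  qed
  have even: "arc_speed (- x) = arc_speed x" for x
  proof -
    have "W (- x) = cnj (W x)" "1 - T * of_real (- x) = cnj (1 - T * of_real x)"
      by (simp_all add: W_def complex_eq_iff)
    then have "phi (- W (- x) / cnj (W (- x))) / (1 - T * of_real (- x)) ^ 2
        = cnj (phi (- W x / cnj (W x)) / (1 - T * of_real x) ^ 2)"
      by (simp flip: phi_cnj)
    then show ?thesis
      unfolding arc_speed_def by (simp only: cnj.simps)
  qed
  show ?thesis
  proof (rule J_arc_bound[OF assms(2) zero_less_one _ _ _ _ _ assms(3,4)])
    show "arc_speed (\<sigma> * (1 * 1 * x)) \<ge> ip_eval r x / 100" if "0 \<le> x" "x \<le> 1" for x
      using pos[OF that] assms(2) even by auto
    show "((\<lambda>x. x * ip_eval [60*4, 30*60, -20*1050, 15*3400, -12*2450] x / 6000) has_real_derivative ip_eval r x / 100) (at x)" for x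
      by (auto simp: r_def field_simps intro!: derivative_eq_intros)
    show "x * ip_eval [60*4, 30*60, -20*1050, 15*3400, -12*2450] x / 6000 \<ge> 0" if "0 \<le> x" "x \<le> 1" for x
      using nonneg_cert_sound[OF nonneg_cert_integrals(2) that] that by (intro divide_nonneg_nonneg mult_nonneg_nonneg) auto
  qed auto
qed

text \<open>The polynomial inequality is affine in \<open>p = a k\<close>, and \<open>p\<^sup>2 = 6/25\<close> places \<open>p\<close> between \<open>0.4898\<close> and
  \<open>0.49\<close>. So it follows from the certificates at these two rational values.\<close>

lemma arc_speed_ge_ext:
  fixes r :: "int list" and \<sigma>\<^sub>i :: int
  assumes "narrow_parameter a k" and a: "a ^ 2 = 2/5" and sg: "\<sigma>\<^sub>i = 1 \<or> \<sigma>\<^sub>i = -1"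
    and cert: "nonneg_cert n (margin_ext \<sigma>\<^sub>i 4898 r)" "nonneg_cert n (margin_ext \<sigma>\<^sub>i 4900 r)"
    and x: "0 \<le> x" "x \<le> 1"
  shows "narrow_parameter.arc_speed a k (of_int \<sigma>\<^sub>i * (k * (13/10) * x)) \<ge> ip_eval r x / 1000"
proof -
  interpret narrow_parameter a k by fact
  define \<sigma> where "\<sigma> = (of_int \<sigma>\<^sub>i :: real)"
  define s where "s = \<sigma> * (k * (13/10) * x)"
  define p where "p = a * k"
  define v where "v = phi_taylor (- W s / cnj (W s))"
  have k2: "k ^ 2 = 3/5"
    using ak a by simp
  have \<sigma>2: "\<sigma> ^ 2 = 1"
    using sg by (auto simp: \<sigma>_def)
  have p2: "p ^ 2 = 6/25"
    by (simp add: p_def power_mult_distrib a k2)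
  have p_pos: "p \<ge> 0"
    using a_nonneg k_pos by (simp add: p_def)
  have p_bounds: "4898 \<le> 10000 * p" "10000 * p \<le> 4900"
    using p2 p_pos power2_le_imp_le[of 4898 "10000 * p"] power2_le_imp_le[of "10000 * p" 4900]
    by (simp_all add: power_mult_distrib)
  have s2: "s ^ 2 = 507/500 * x ^ 2"
    by (simp add: s_def power_mult_distrib \<sigma>2 k2 power_divide)
  have as: "a * s = 13/10 * \<sigma> * p * x" and ks: "k * s = 39/50 * \<sigma> * x"
    using k2 by (simp_all add: s_def p_def power2_eq_square)
  define \<beta> where "\<beta> = 26000000 * \<sigma> * x * Re v - 20280000 * x ^ 2 * Im v - 13000 * \<sigma> * x
      - ip_eval r x * (52000 * \<sigma> * x + 52728 * \<sigma> * x ^ 3)"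
  define \<alpha> where "\<alpha> = (100000000000 - 20280000000 * x ^ 2) * Re v - 156000000000 * \<sigma> * x * Im v
      - (50000000 + 50700000 * x ^ 2) - ip_eval r x * (100000000 + 365040000 * x ^ 2 + 102819600 * x ^ 4)"
  have endpoint: "\<alpha> + \<beta> * of_int P \<ge> 0" if "nonneg_cert n (margin_ext \<sigma>\<^sub>i P r)" for P
  proof -
    let ?A = "[100000000000, 26000000 * \<sigma>\<^sub>i * P, -20280000000]" and ?B = "[0, 156000000000 * \<sigma>\<^sub>i, 20280000 * P]"
    let ?C = "ip_add [50000000, 13000 * \<sigma>\<^sub>i * P, 50700000]
       (ip_mult r [100000000, 52000 * \<sigma>\<^sub>i * P, 365040000, 52728 * \<sigma>\<^sub>i * P, 102819600])"
    define z where "z = Complex (ip_eval [500, 0, -507] x) (ip_eval [0, 780 * \<sigma>\<^sub>i] x)"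
    have z: "z = 500 * W s"
    proof -
      have "W s = Complex (1 - 507/500 * x ^ 2) (2 * (39/50 * \<sigma> * x))"
        unfolding W_def s2 mult.assoc ks by simp
      moreover have "z = Complex (500 - 507 * x ^ 2) (780 * \<sigma> * x)"
        by (simp add: z_def \<sigma>_def power2_eq_square)
      ultimately show ?thesis
        by (simp add: complex_eq_iff)
    qed
    then have z_nz: "z \<noteq> 0"
      using W_nz by simp
    have "ip_eval ?C x \<le> ip_eval ?A x * Re (phi_taylor (- z / cnj z)) - ip_eval ?B x * Im (phi_taylor (- z / cnj z))"
      using nonneg_cert_sound[OF that x] unfolding margin_ext_def by (rule margin_poly_sound[OF _ z_def z_nz])
    moreover have "- z / cnj z = - W s / cnj (W s)"
      by (simp add: z)
    ultimately have C_le: "ip_eval ?C x \<le> ip_eval ?A x * Re v - ip_eval ?B x * Im v"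
      by (simp only: v_def)
    have "ip_eval ?A x * Re v - ip_eval ?B x * Im v - ip_eval ?C x = \<alpha> + \<beta> * of_int P"
      unfolding ip_eval_add ip_eval_mult \<alpha>_def \<beta>_def
      by (simp only: ip_eval.simps of_int_mult of_int_numeral of_int_minus of_int_0 \<sigma>_def[symmetric])
        (simp add: power2_eq_square power3_eq_cube power4_eq_xxxx algebra_simps)
    then show ?thesis
      using C_le by (metis diff_ge_0_iff_ge)
  qed
  have *: "\<alpha> + \<beta> * (10000 * p) \<ge> 0"
    by (rule affine_nonneg_between[of \<alpha> \<beta> 4898 4900])
      (use endpoint[OF cert(1)] endpoint[OF cert(2)] p_bounds in simp_all)
  show ?thesis
    unfolding \<sigma>_def[symmetric] s_def[symmetric]
  proof (rule arc_speed_ge)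
    define m where "m = 1 + 2 * a * s + s ^ 2"
    define D where "D = (1 - cnj T * of_real s) ^ 2"
    have m: "m = 1 + 13/5 * \<sigma> * p * x + 507/500 * x ^ 2"
      using as by (simp add: m_def s2)
    have "m ^ 2 = (1 + 507/500 * x ^ 2) ^ 2 + 169/25 * \<sigma> ^ 2 * p ^ 2 * x ^ 2 + 26/5 * \<sigma> * p * x * (1 + 507/500 * x ^ 2)"
      unfolding m by (simp add: power2_eq_square field_simps)
    then have m2: "m ^ 2 = (1 + 507/500 * x ^ 2) ^ 2 + 1014/625 * x ^ 2 + 26/5 * \<sigma> * p * x * (1 + 507/500 * x ^ 2)"
      unfolding \<sigma>2 p2 by simp
    have "1 - cnj T * of_real s = Complex (1 + 13/10 * \<sigma> * p * x) (39/50 * \<sigma> * x)"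
      using as ks by (simp add: complex_eq_iff)
    then have "D = (Complex (1 + 13/10 * \<sigma> * p * x) (39/50 * \<sigma> * x)) ^ 2"
      by (simp only: D_def)
    then have "Re D = 1 + 13/5 * \<sigma> * p * x + 169/100 * \<sigma> ^ 2 * p ^ 2 * x ^ 2 - 1521/2500 * \<sigma> ^ 2 * x ^ 2"
        "Im D = 39/25 * \<sigma> * x + 507/250 * \<sigma> ^ 2 * p * x ^ 2"
      by (simp_all add: power2_eq_square field_simps)
    then have D: "Re D = 1 + 13/5 * \<sigma> * p * x - 507/2500 * x ^ 2" "Im D = 39/25 * \<sigma> * x + 507/250 * p * x ^ 2"
      unfolding \<sigma>2 p2 by simp_all
    have "100000000000 * (Re D * Re v - Im D * Im v - (m / 2000 + ip_eval r x / 1000 * m ^ 2)) = \<alpha> + \<beta> * (10000 * p)"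
      unfolding D m2 unfolding m \<alpha>_def \<beta>_def by (simp add: power2_eq_square power3_eq_cube power4_eq_xxxx field_simps)
    then have "m / 2000 + ip_eval r x / 1000 * m ^ 2 \<le> Re D * Re v - Im D * Im v"
      using * by simp
    then show "(1 + 2 * a * s + s ^ 2) / 2000 + ip_eval r x / 1000 * (1 + 2 * a * s + s ^ 2) ^ 2
        \<le> Re ((1 - cnj T * of_real s) ^ 2 * phi_taylor (- W s / cnj (W s)))"
      unfolding m_def[symmetric] D_def[symmetric] v_def[symmetric] by simp
  qed
qed

lemma arc_bounds_ext:
  assumes "narrow_map a k f" and a: "a ^ 2 = 2/5" and s: "0 \<le> s" "s \<le> 1"
  shows "narrow_map.J a k f (narrow_parameter.T a k) \<le> narrow_map.J a k f (narrow_parameter.arc a k s)"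
    and "narrow_map.J a k f (narrow_parameter.arc a k (- s)) \<le> narrow_map.J a k f (narrow_parameter.T a k)"
proof -
  interpret narrow_map a k f by fact
  have par: "narrow_parameter a k"
    by unfold_locales
  have "(10/13) ^ 2 \<le> k ^ 2"
    using ak a by (simp add: power2_eq_square)
  then have kX: "k * (13/10) \<ge> 1"
    using power2_le_imp_le[of "10/13" k] k_pos by simp
  have "1 * J T \<le> 1 * J (arc (1 * s))"
  proof (rule J_arc_bound[where X = "13/10", OF _ _ kX _ _ _ _ s])
    define r where "r = [45, 300, -5000, 12600, -7200 :: int]"
    show "arc_speed (1 * (k * (13/10) * x)) \<ge> ip_eval r x / 1000" if "0 \<le> x" "x \<le> 1" for x
      using arc_speed_ge_ext[OF par a _ nonneg_cert_left that] by (simp add: r_def)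
    show "((\<lambda>x. x * ip_eval [12*45, 6*300, -4*5000, 3*12600, -12*1440] x / 12000) has_real_derivative ip_eval r x / 1000) (at x)" for x
      by (auto simp: r_def field_simps intro!: derivative_eq_intros)
    show "x * ip_eval [12*45, 6*300, -4*5000, 3*12600, -12*1440] x / 12000 \<ge> 0" if "0 \<le> x" "x \<le> 1" for x
      using nonneg_cert_sound[OF nonneg_cert_integrals(1) that] that by (intro divide_nonneg_nonneg mult_nonneg_nonneg) auto
  qed auto
  then show "J T \<le> J (arc s)"
    by simp
  have "- 1 * J T \<le> - 1 * J (arc (- 1 * s))"
  proof (rule J_arc_bound[where X = "13/10", OF _ _ kX _ _ _ _ s])
    define r where "r = [50, 0, 2000, -41000, 137000, -107000 :: int]"
    show "arc_speed (- 1 * (k * (13/10) * x)) \<ge> ip_eval r x / 1000" if "0 \<le> x" "x \<le> 1" for x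
      using arc_speed_ge_ext[OF par a _ nonneg_cert_right that] by (simp add: r_def)
    show "((\<lambda>x. x * ip_eval [60*50, 0, 20*2000, -15*41000, 12*137000, -10*107000] x / 60000) has_real_derivative ip_eval r x / 1000) (at x)" for x
      by (auto simp: r_def field_simps intro!: derivative_eq_intros)
    show "x * ip_eval [60*50, 0, 20*2000, -15*41000, 12*137000, -10*107000] x / 60000 \<ge> 0" if "0 \<le> x" "x \<le> 1" for x
      using nonneg_cert_sound[OF nonneg_cert_integrals(3) that] that by (intro divide_nonneg_nonneg mult_nonneg_nonneg) auto
  qed auto
  then show "J (arc (- s)) \<le> J T"
    by simp
qed

section \<open>Coefficients\<close>

text \<open>The bound for the second coefficient is the Schwarz-Pick inequality at 0 for \<open>\<psi> z = \<omega> z / z\<close>: the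
  Schwarz lemma is applied to \<open>\<psi>\<close> followed by the disc automorphism that moves \<open>\<psi> 0\<close> to 0.\<close>

lemma schwarz_coefficients:
  assumes "schwarz_function \<omega>"
  defines "F \<equiv> fps_expansion \<omega> 0"
  shows "fps_nth F 0 = 0" "norm (fps_nth F 1) \<le> 1" "norm (fps_nth F 2) \<le> 1 - norm (fps_nth F 1) ^ 2"
    "\<omega> has_fps_expansion F"
proof -
  have holo: "\<omega> holomorphic_on ball 0 1" and w0: "\<omega> 0 = 0" and lt: "\<And>z. norm z < 1 \<Longrightarrow> norm (\<omega> z) < 1"
    using assms(1) by (auto simp: schwarz_function_def)
  show exp: "\<omega> has_fps_expansion F"
    unfolding F_def by (intro has_fps_expansion_fps_expansion[of "ball 0 1"] holo) auto
  show F0: "fps_nth F 0 = 0"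
    using has_fps_expansion_imp_0_eq_fps_nth_0[OF exp] w0 by simp
  have F1: "fps_nth F 1 = deriv \<omega> 0"
    by (simp add: F_def fps_expansion_def)
  show le1: "norm (fps_nth F 1) \<le> 1"
    unfolding F1 using Schwarz_Lemma(2)[OF holo w0 lt, of 0] by simp
  show "norm (fps_nth F 2) \<le> 1 - norm (fps_nth F 1) ^ 2"
  proof (cases "norm (fps_nth F 1) = 1")
    case True
    obtain \<alpha> where \<alpha>: "\<And>z. norm z < 1 \<Longrightarrow> \<omega> z = \<alpha> * z" "norm \<alpha> = 1"
      using Schwarz_Lemma(3)[OF holo w0 lt, of 0] True unfolding F1 by auto
    have "eventually (\<lambda>z. z \<in> ball (0::complex) 1) (nhds 0)"
      by (intro eventually_nhds_in_open) auto
    then have "eventually (\<lambda>z. \<omega> z = \<alpha> * z) (nhds 0)"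
      by eventually_elim (use \<alpha> in auto)
    moreover have "(\<lambda>z. \<alpha> * z) has_fps_expansion (fps_const \<alpha> * fps_X)"
      by (intro fps_expansion_intros)
    ultimately have "\<omega> has_fps_expansion (fps_const \<alpha> * fps_X)"
      by (simp cong: has_fps_expansion_cong)
    then have "F = fps_const \<alpha> * fps_X"
      using exp fps_expansion_unique_complex by blast
    then have "fps_nth F 2 = 0"
      by simp
    then show ?thesis
      using True by simp
  next
    case False
    define c where "c = fps_nth F 1"
    have c_deriv: "c = deriv \<omega> 0"
      unfolding c_def F1 ..
    have c: "norm c < 1"
      using False le1 by (simp add: c_def)
    define \<psi> where "\<psi> z = (if z = 0 then c else \<omega> z / z)" for z
    define G where "G = fps_expansion \<psi> 0"
    have psi_holo: "\<psi> holomorphic_on ball 0 1"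
    proof -
      obtain q where q: "q holomorphic_on ball 0 1" "\<And>z. norm z < 1 \<Longrightarrow> \<omega> z = z * q z" "deriv \<omega> 0 = q 0"
        using Schwarz3[OF holo w0] by blast
      show ?thesis
        using q(1) by (rule holomorphic_transform) (use q(2,3) in \<open>auto simp: \<psi>_def c_deriv\<close>)
    qed
    have psi_exp: "\<psi> has_fps_expansion G"
      unfolding G_def by (intro has_fps_expansion_fps_expansion[of "ball 0 1"] psi_holo) auto
    have "(\<lambda>z. z * \<psi> z) has_fps_expansion fps_X * G"
      by (intro fps_expansion_intros psi_exp)
    moreover have "(\<lambda>z. z * \<psi> z) = \<omega>"
      by (auto simp: \<psi>_def w0)
    ultimately have "fps_X * G = F"
      using exp fps_expansion_unique_complex by simp
    then have G: "fps_nth G 0 = c" "fps_nth G 1 = fps_nth F 2"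
      by (auto simp: c_def numeral_2_eq_2)
    have psi_le: "norm (\<psi> z) \<le> 1" if "norm z < 1" for z
      using Schwarz_Lemma(1)[OF holo w0 lt that] le1 by (auto simp: \<psi>_def c_def norm_divide divide_le_eq)
    have psi_lt: "norm (\<psi> z) < 1" if z: "norm z < 1" for z
    proof (rule ccontr)
      assume "\<not> norm (\<psi> z) < 1"
      then have "norm (\<psi> z) = 1"
        using psi_le[OF z] by simp
      then have "z \<noteq> 0" "norm (\<omega> z) = norm z"
        using c by (auto simp: \<psi>_def norm_divide split: if_splits)
      then obtain \<alpha> where \<alpha>: "\<And>z. norm z < 1 \<Longrightarrow> \<omega> z = \<alpha> * z" "norm \<alpha> = 1"
        using Schwarz_Lemma(3)[OF holo w0 lt z] z by auto
      have "(\<omega> has_field_derivative \<alpha>) (at 0)"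
      proof (rule has_field_derivative_transform_within_open)
        show "((\<lambda>z. \<alpha> * z) has_field_derivative \<alpha>) (at 0)"
          by (auto intro!: derivative_eq_intros)
        show "\<alpha> * z = \<omega> z" if "z \<in> ball 0 1" for z
          using \<alpha>(1) that by simp
      qed auto
      then show False
        using False \<alpha>(2) unfolding F1 by (simp add: DERIV_imp_deriv)
    qed
    define \<theta> where "\<theta> z = (\<psi> z - c) / (1 - cnj c * \<psi> z)" for z
    \<comment> \<open>This identity shows that \<open>\<theta>\<close> below maps into the unit disc.\<close>
    have gap: "norm (1 - cnj c * u) ^ 2 - norm (u - c) ^ 2 = (1 - norm c ^ 2) * (1 - norm u ^ 2)" for u
      by (simp only: cmod_power2) (simp add: power2_eq_square algebra_simps)
    have th_less: "norm (\<psi> z - c) < norm (1 - cnj c * \<psi> z)" if z: "norm z < 1" for z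
    proof -
      have "(1 - norm c ^ 2) * (1 - norm (\<psi> z) ^ 2) > 0"
        using c psi_lt[OF z] by (intro mult_pos_pos) (simp_all add: power_less_one_iff)
      then have "norm (\<psi> z - c) ^ 2 < norm (1 - cnj c * \<psi> z) ^ 2"
        using gap[of "\<psi> z"] by linarith
      then show ?thesis
        by (rule power2_less_imp_less) simp
    qed
    have nz: "1 - cnj c * \<psi> z \<noteq> 0" if "norm z < 1" for z
      using th_less[OF that] by (metis norm_ge_zero norm_zero not_less)
    have th_holo: "\<theta> holomorphic_on ball 0 1"
      unfolding \<theta>_def using nz by (intro holomorphic_intros psi_holo) auto
    have th0: "\<theta> 0 = 0"
      by (simp add: \<theta>_def \<psi>_def)
    have th_lt: "norm (\<theta> z) < 1" if z: "norm z < 1" for z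
      using th_less[OF z] nz[OF z] by (simp add: \<theta>_def norm_divide)
    define \<Theta> where "\<Theta> = fps_expansion \<theta> 0"
    have th_exp: "\<theta> has_fps_expansion \<Theta>"
      unfolding \<Theta>_def by (intro has_fps_expansion_fps_expansion[of "ball 0 1"] th_holo) auto
    have Th0: "fps_nth \<Theta> 0 = 0"
      using has_fps_expansion_imp_0_eq_fps_nth_0[OF th_exp] th0 by simp
    have "norm (deriv \<theta> 0) \<le> 1"
      using Schwarz_Lemma(2)[OF th_holo th0 th_lt, of 0] by simp
    then have Th1: "norm (fps_nth \<Theta> 1) \<le> 1"
      by (simp add: \<Theta>_def fps_expansion_def)
    have ev1: "eventually (\<lambda>z. z \<in> ball (0::complex) 1) (nhds 0)"
      by (intro eventually_nhds_in_open) auto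
    have "(\<lambda>z. \<theta> z * (1 - cnj c * \<psi> z)) has_fps_expansion (\<Theta> * (1 - fps_const (cnj c) * G))"
      by (intro fps_expansion_intros th_exp psi_exp)
    moreover have "eventually (\<lambda>z. \<theta> z * (1 - cnj c * \<psi> z) = \<psi> z - c) (nhds 0)"
      using ev1 by eventually_elim (use nz in \<open>auto simp: \<theta>_def\<close>)
    ultimately have "(\<lambda>z. \<psi> z - c) has_fps_expansion (\<Theta> * (1 - fps_const (cnj c) * G))"
      by (simp cong: has_fps_expansion_cong)
    moreover have "(\<lambda>z. \<psi> z - c) has_fps_expansion G - fps_const c"
      by (intro fps_expansion_intros psi_exp)
    ultimately have "\<Theta> * (1 - fps_const (cnj c) * G) = G - fps_const c"
      by (rule fps_expansion_unique_complex)
    then have "fps_nth (\<Theta> * (1 - fps_const (cnj c) * G)) 1 = fps_nth (G - fps_const c) 1"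
      by simp
    then have "fps_nth \<Theta> 1 * (1 - cnj c * c) = fps_nth F 2"
      using Th0 G by (simp add: fps_mult_nth)
    then have "norm (fps_nth F 2) = norm (fps_nth \<Theta> 1) * norm (1 - cnj c * c)"
      by (metis norm_mult)
    also have "1 - cnj c * c = of_real (1 - norm c ^ 2)"
      using complex_norm_square[of c] by (simp add: mult.commute)
    also have "norm (of_real (1 - norm c ^ 2) :: complex) = 1 - norm c ^ 2"
      using c by (simp only: norm_of_real) (simp add: power_le_one)
    also have "norm (fps_nth \<Theta> 1) * (1 - norm c ^ 2) \<le> 1 * (1 - norm c ^ 2)"
      using Th1 c by (intro mult_right_mono) (simp_all add: power_le_one)
    finally show ?thesis
      by (simp add: c_def)
  qed
qed

lemma phi_has_fps_expansion: "phi has_fps_expansion fps_exp 1 * (1 + fps_sin 1)"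
  unfolding phi_def[abs_def] by (intro fps_expansion_intros)

lemma fps_compose_nth_small:
  fixes A B :: "complex fps"
  assumes "fps_nth A 0 = 0"
  shows "fps_nth (B oo A) 1 = fps_nth B 1 * fps_nth A 1"
    and "fps_nth (B oo A) 2 = fps_nth B 1 * fps_nth A 2 + fps_nth B 2 * fps_nth A 1 ^ 2"
    and "fps_nth (B oo A) 3 = fps_nth B 1 * fps_nth A 3 + fps_nth B 2 * (2 * fps_nth A 1 * fps_nth A 2)
           + fps_nth B 3 * fps_nth A 1 ^ 3"
  using assms by (simp_all add: fps_compose_nth fps_mult_nth eval_nat_numeral algebra_simps)

text \<open>Reverting the power series of \<open>f\<close> gives the Taylor coefficients of the inverse up to order three;
  those of the logarithm follow from \<open>exp (L w) = disc_inverse f w / w\<close>.\<close>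

lemma log_inverse_coeff_eq:
  assumes f: "f \<in> schlicht" and A: "f has_fps_expansion A"
  shows "log_inverse_coeff f 1 = - fps_nth A 2 / 2"
    and "log_inverse_coeff f 2 = 3/4 * fps_nth A 2 ^ 2 - fps_nth A 3 / 2"
proof -
  have holo: "f holomorphic_on ball 0 1" and inj: "inj_on f (ball 0 1)" and f0: "f 0 = 0" and f1: "deriv f 0 = 1"
    using f by (auto simp: schlicht_def)
  have A0: "fps_nth A 0 = 0" and A1: "fps_nth A 1 = 1"
    using f0 f1 by (simp_all add: fps_nth_fps_expansion[OF A])
  define g where "g = disc_inverse f"
  have gf: "g (f z) = z" if "z \<in> ball 0 1" for z
    unfolding g_def disc_inverse_def by (rule the_inv_into_f_f[OF inj that])
  obtain g' where g': "g' holomorphic_on f ` ball 0 1" "\<And>z. z \<in> ball 0 1 \<Longrightarrow> g' (f z) = z"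
    using holomorphic_has_inverse[OF holo open_ball inj] by metis
  have g_holo: "g holomorphic_on f ` ball 0 1"
    using g'(1) by (rule holomorphic_transform) (use g'(2) gf in auto)
  have op: "open (f ` ball 0 1)"
    by (rule open_mapping_thm3[OF holo open_ball inj])
  have zero: "0 \<in> f ` ball 0 1"
    using f0 by force
  define B where "B = fps_expansion g 0"
  have B: "g has_fps_expansion B"
    unfolding B_def by (rule has_fps_expansion_fps_expansion[OF op zero g_holo])
  have g0: "g 0 = 0"
    using gf[of 0] f0 by simp
  have B0: "fps_nth B 0 = 0"
    using has_fps_expansion_imp_0_eq_fps_nth_0[OF B] g0 by simp
  have ev1: "eventually (\<lambda>z. z \<in> ball (0::complex) 1) (nhds 0)"
    by (intro eventually_nhds_in_open) auto
  have "(g \<circ> f) has_fps_expansion (B oo A)"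
    by (intro has_fps_expansion_compose A B A0)
  moreover have "eventually (\<lambda>z. (g \<circ> f) z = z) (nhds 0)"
    using ev1 by eventually_elim (use gf in auto)
  ultimately have "(\<lambda>z. z) has_fps_expansion (B oo A)"
    by (simp cong: has_fps_expansion_cong)
  then have BA: "B oo A = fps_X"
    using has_fps_expansion_fps_X fps_expansion_unique_complex by blast
  have B1: "fps_nth B 1 = 1"
    using fps_compose_nth_small(1)[OF A0, of B] A1 by (simp add: BA)
  have B2: "fps_nth B 2 = - fps_nth A 2"
    using fps_compose_nth_small(2)[OF A0, of B] A1 B1 by (simp add: BA eq_neg_iff_add_eq_0 add.commute)
  have "fps_nth A 3 + fps_nth B 2 * (2 * fps_nth A 2) + fps_nth B 3 = 0"
    using fps_compose_nth_small(3)[OF A0, of B] A1 B1 by (simp add: BA)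
  then have B3: "fps_nth B 3 = 2 * fps_nth A 2 ^ 2 - fps_nth A 3"
    unfolding B2 by (simp add: power2_eq_square algebra_simps add_eq_0_iff)
  define h where "h w = (if w = 0 then 1 else g w / w)" for w
  define H where "H = fps_shift 1 B"
  have "(\<lambda>w. if w = 0 then 1 else g w / w ^ 1) has_fps_expansion H"
    unfolding H_def using B0 B1 by (intro has_fps_expansion_shift B) (auto intro!: subdegree_geI)
  then have H: "h has_fps_expansion H"
    unfolding power_one_right h_def[abs_def] .
  have h0: "h 0 = 1"
    by (simp add: h_def)
  define L where "L w = Ln (h w)" for w
  have "h analytic_on {0}"
    by (rule has_fps_expansion_imp_analytic_0[OF H])
  then have "L analytic_on {0}"
    unfolding L_def by (intro analytic_intros) (auto simp: h0)
  then have L: "L has_fps_expansion fps_expansion L 0"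
    by (rule analytic_at_imp_has_fps_expansion_0)
  define C where "C = fps_expansion L 0"
  have C0: "fps_nth C 0 = 0"
    using has_fps_expansion_imp_0_eq_fps_nth_0[OF L] by (simp add: C_def L_def h0)
  have "(exp \<circ> L) has_fps_expansion (fps_exp 1 oo C)"
    using L C0 unfolding C_def by (intro has_fps_expansion_compose) (auto intro: fps_expansion_intros)
  moreover have "eventually (\<lambda>w. (exp \<circ> L) w = h w) (nhds 0)"
  proof -
    have "isCont h 0"
      using \<open>h analytic_on {0}\<close> analytic_at_imp_isCont by blast
    then have "(h \<longlongrightarrow> h 0) (nhds 0)"
      by (simp add: isCont_def tendsto_nhds_iff)
    then have "eventually (\<lambda>w. h w \<noteq> 0) (nhds 0)"
      by (rule tendsto_imp_eventually_ne) (simp add: h0)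
    then show ?thesis
      by eventually_elim (simp add: L_def)
  qed
  ultimately have "h has_fps_expansion (fps_exp 1 oo C)"
    by (simp cong: has_fps_expansion_cong)
  then have HC: "fps_exp 1 oo C = H"
    using H fps_expansion_unique_complex by blast
  have C1: "fps_nth C 1 = - fps_nth A 2"
    using fps_compose_nth_small(1)[OF C0, of "fps_exp 1"] B2 unfolding HC by (simp add: H_def numeral_2_eq_2)
  have "2 * fps_nth A 2 ^ 2 - fps_nth A 3 = fps_nth C 2 + fps_nth C 1 ^ 2 / 2"
    using fps_compose_nth_small(2)[OF C0, of "fps_exp 1"] B3 unfolding HC by (simp add: H_def numeral_3_eq_3 numeral_2_eq_2)
  then have C2: "fps_nth C 2 = 3/2 * fps_nth A 2 ^ 2 - fps_nth A 3"
    unfolding C1 by (simp add: field_simps)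
  have nth: "log_inverse_coeff f n = fps_nth C n / 2" for n
    unfolding log_inverse_coeff_def C_def L_def h_def g_def ..
  show "log_inverse_coeff f 1 = - fps_nth A 2 / 2" "log_inverse_coeff f 2 = 3/4 * fps_nth A 2 ^ 2 - fps_nth A 3 / 2"
    unfolding nth C1 C2 by (simp_all add: field_simps)
qed

lemma log_inverse_coeff_subordinate:
  assumes f: "f \<in> schlicht" and w: "schwarz_function \<omega>"
    and eq: "\<forall>z\<in>ball 0 1. deriv f z = phi (\<omega> z)"
  defines "F \<equiv> fps_expansion \<omega> 0"
  shows "log_inverse_coeff f 1 = - fps_nth F 1 / 2"
    and "log_inverse_coeff f 2 = fps_nth F 1 ^ 2 / 2 - fps_nth F 2 / 3"
proof -
  note sw = schwarz_coefficients[OF w, folded F_def]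
  define A where "A = fps_expansion f 0"
  have A: "f has_fps_expansion A"
    unfolding A_def using f by (intro has_fps_expansion_fps_expansion[of "ball 0 1"]) (auto simp: schlicht_def)
  have ev1: "eventually (\<lambda>z. z \<in> ball (0::complex) 1) (nhds 0)"
    by (intro eventually_nhds_in_open) auto
  have "(phi \<circ> \<omega>) has_fps_expansion ((fps_exp 1 * (1 + fps_sin 1)) oo F)"
    by (intro has_fps_expansion_compose phi_has_fps_expansion sw)
  moreover have "eventually (\<lambda>z. (phi \<circ> \<omega>) z = deriv f z) (nhds 0)"
    using ev1 by eventually_elim (use eq in simp)
  ultimately have "deriv f has_fps_expansion ((fps_exp 1 * (1 + fps_sin 1)) oo F)"
    by (simp cong: has_fps_expansion_cong)
  then have dA: "fps_deriv A = (fps_exp 1 * (1 + fps_sin 1)) oo F"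
    using has_fps_expansion_deriv[OF A] fps_expansion_unique_complex by blast
  have P: "fps_nth (fps_exp 1 * (1 + fps_sin 1)) 1 = (2 :: complex)" "fps_nth (fps_exp 1 * (1 + fps_sin 1)) 2 = (3/2 :: complex)"
    by (simp_all add: fps_mult_nth fps_sin_def eval_nat_numeral)
  have "fps_nth (fps_deriv A) 1 = 2 * fps_nth F 1"
    unfolding dA fps_compose_nth_small(1)[OF sw(1)] P ..
  then have A2: "fps_nth A 2 = fps_nth F 1"
    by (simp add: numeral_2_eq_2)
  have "fps_nth (fps_deriv A) 2 = 2 * fps_nth F 2 + 3/2 * fps_nth F 1 ^ 2"
    unfolding dA fps_compose_nth_small(2)[OF sw(1)] P ..
  then have "3 * fps_nth A 3 = 2 * fps_nth F 2 + 3/2 * fps_nth F 1 ^ 2"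
    by (simp add: numeral_3_eq_3 numeral_2_eq_2)
  then have A3: "fps_nth A 3 = 2/3 * fps_nth F 2 + fps_nth F 1 ^ 2 / 2"
    by (simp add: field_simps)
  show "log_inverse_coeff f 1 = - fps_nth F 1 / 2" "log_inverse_coeff f 2 = fps_nth F 1 ^ 2 / 2 - fps_nth F 2 / 3"
    unfolding log_inverse_coeff_eq[OF f A] A2 A3 by (simp_all add: field_simps)
qed

text \<open>For the lower bound, if \<open>\<bar>c\<bar> \<le> 2 / sqrt 10\<close> the first norm is simply dropped; beyond that value
  it is at least \<open>\<bar>c\<bar>\<^sup>2/2 - (1 - \<bar>c\<bar>\<^sup>2)/3\<close>, which is nonnegative and grows faster than \<open>\<bar>c\<bar>/2\<close>.\<close>

lemma coefficient_estimate:
  fixes c d :: complex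
  assumes c: "norm c \<le> 1" and d: "norm d \<le> 1 - norm c ^ 2"
  shows "- (1 / sqrt 10) \<le> norm (c ^ 2 / 2 - d / 3) - norm (- c / 2)"
    and "norm (c ^ 2 / 2 - d / 3) - norm (- c / 2) \<le> 1 / 3"
proof -
  define x where "x = norm c"
  define N where "N = norm (c ^ 2 / 2 - d / 3)"
  define s where "s = 1 / sqrt 10"
  have x: "0 \<le> x" "x \<le> 1"
    using c by (simp_all add: x_def)
  have half: "norm (- c / 2) = x / 2"
    by (simp add: x_def norm_divide)
  have nc: "norm (c ^ 2 / 2) = x ^ 2 / 2" and nd: "norm (d / 3) \<le> (1 - x ^ 2) / 3"
    using d by (simp_all add: norm_divide norm_power x_def)
  have "N \<le> norm (c ^ 2 / 2) + norm (d / 3)"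
    unfolding N_def by (rule norm_triangle_ineq4)
  then have "N \<le> x ^ 2 / 2 + (1 - x ^ 2) / 3"
    using nc nd by linarith
  moreover have "x ^ 2 \<le> x"
    using x by (simp add: power2_eq_square mult_left_le)
  ultimately show "N - norm (- c / 2) \<le> 1 / 3"
    using x(1) unfolding half by argo
  have "norm (c ^ 2 / 2) - norm (d / 3) \<le> N"
    unfolding N_def by (rule norm_triangle_ineq2)
  then have lower: "x ^ 2 / 2 - (1 - x ^ 2) / 3 \<le> N"
    using nc nd by linarith
  have s2: "s ^ 2 = 1/10" and s_pos: "s > 0"
    by (simp_all add: s_def power_divide)
  have "3/10 \<le> s"
    by (rule power2_le_imp_le) (use s2 s_pos in \<open>simp_all add: power_divide\<close>)
  have "- s \<le> N - x / 2"
  proof (cases "x \<le> 2 * s")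
    case True
    then show ?thesis
      using norm_ge_zero[of "c ^ 2 / 2 - d / 3"] unfolding N_def[symmetric] by simp
  next
    case False
    have "(x - 2 * s) * (5/6 * (x + 2 * s) - 1/2) \<ge> 0"
      using False \<open>3/10 \<le> s\<close> by (intro mult_nonneg_nonneg) auto
    moreover have "(x - 2 * s) * (5/6 * (x + 2 * s) - 1/2) = 5/6 * x ^ 2 - x / 2 - 10/3 * s ^ 2 + s"
      by (simp add: power2_eq_square field_simps)
    ultimately show ?thesis
      using lower unfolding s2 by argo
  qed
  then show "- (1 / sqrt 10) \<le> N - norm (- c / 2)"
    unfolding half s_def .
qed

section \<open>Extremal functions and the sharp bounds\<close>

text \<open>A primitive exists on the disc of radius 3/2 because it contains no zero of the denominator of \<open>w\<close>. The
  larger disc makes the unit circle available to \<open>J\<close>.\<close>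

lemma narrow_map_exists:
  assumes "narrow_parameter a k"
  obtains f where "narrow_map a k f"
proof -
  interpret narrow_parameter a k by fact
  have "(\<lambda>z. phi (w z)) holomorphic_on ball 0 (3/2)"
    unfolding phi_def blaschke2_def using denom_nz by (auto intro!: holomorphic_intros)
  then obtain g where g: "\<And>z. z \<in> ball 0 (3/2) \<Longrightarrow> (g has_field_derivative phi (w z)) (at z)"
    using holomorphic_convex_primitive'[of "ball 0 (3/2)" "\<lambda>z. phi (w z)"] by (auto simp: at_within_open[of _ "ball 0 (3/2)"])
  have "narrow_map a k (\<lambda>z. g z - g 0)"
  proof unfold_locales
    show "((\<lambda>z. g z - g 0) has_field_derivative phi (w z)) (at z)" if "norm z < 3/2" for z
      using that by (auto intro!: derivative_eq_intros g)
  qed simp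
  then show ?thesis
    by (rule that)
qed

lemma (in narrow_parameter) schwarz_blaschke2: "schwarz_function w"
  unfolding schwarz_function_def
proof (intro conjI ballI)
  show "w holomorphic_on ball 0 1"
    unfolding blaschke2_def[abs_def] using denom_nz by (auto intro!: holomorphic_intros)
  show "w 0 = 0"
    by (simp add: blaschke2_def)
  show "norm (w z) < 1" if "z \<in> ball 0 1" for z
    using norm_w_le[of z] that by simp
qed

lemma (in narrow_parameter) blaschke2_coefficients:
  "fps_nth (fps_expansion w 0) 1 = of_real a" "fps_nth (fps_expansion w 0) 2 = of_real (k ^ 2)"
proof -
  define B where "B = fps_expansion w 0"
  note sw = schwarz_coefficients[OF schwarz_blaschke2, folded B_def]
  have "(\<lambda>z. w z * (1 + of_real a * z)) has_fps_expansion B * (1 + fps_const (of_real a) * fps_X)"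
    by (intro fps_expansion_intros sw)
  moreover have "eventually (\<lambda>z. z \<in> ball (0::complex) 1) (nhds 0)"
    by (intro eventually_nhds_in_open) auto
  then have "eventually (\<lambda>z. w z * (1 + of_real a * z) = z * (z + of_real a)) (nhds 0)"
    by eventually_elim (use denom_nz in \<open>simp add: blaschke2_def\<close>)
  ultimately have "(\<lambda>z::complex. z * (z + of_real a)) has_fps_expansion B * (1 + fps_const (of_real a) * fps_X)"
    by (simp cong: has_fps_expansion_cong)
  moreover have "(\<lambda>z::complex. z * (z + of_real a)) has_fps_expansion fps_X * (fps_X + fps_const (of_real a))"
    by (intro fps_expansion_intros)
  ultimately have eq: "B * (1 + fps_const (of_real a) * fps_X) = fps_X * (fps_X + fps_const (of_real a))"
    by (rule fps_expansion_unique_complex)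
  have n1: "fps_nth B 1 = of_real a"
    using arg_cong[OF eq, of "\<lambda>F. fps_nth F 1"] sw(1) by (simp add: fps_mult_nth)
  have "fps_nth B 2 + fps_nth B 1 * of_real a = 1"
    using arg_cong[OF eq, of "\<lambda>F. fps_nth F 2"] sw(1) by (simp add: fps_mult_nth eval_nat_numeral add.commute)
  then have "fps_nth B 2 = of_real (1 - a ^ 2)"
    unfolding n1 by (simp add: power2_eq_square eq_diff_eq)
  then show "fps_nth (fps_expansion w 0) 1 = of_real a" "fps_nth (fps_expansion w 0) 2 = of_real (k ^ 2)"
    using n1 unfolding k_sq B_def by simp_all
qed

lemma (in narrow_map) extremal_map:
  assumes inj: "inj_on f (ball 0 1)"
  shows "f \<in> P_star"
    and "log_inverse_coeff f 1 = - of_real a / 2"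
    and "log_inverse_coeff f 2 = of_real (a ^ 2 / 2 - k ^ 2 / 3)"
proof -
  have d: "deriv f z = phi (w z)" if "norm z < 3/2" for z
    using f_deriv[OF that] by (rule DERIV_imp_deriv)
  have holo: "f holomorphic_on ball 0 1"
    unfolding holomorphic_on_open[OF open_ball] using f_deriv by force
  have schl: "f \<in> schlicht"
    using inj holo f_0 d[of 0] by (simp add: schlicht_def blaschke2_def phi_def)
  have "subordinate (deriv f) (\<lambda>z. exp z * (1 + sin z))"
    unfolding subordinate_def
  proof (intro conjI exI[of _ w])
    show "deriv f holomorphic_on ball 0 1"
      by (rule holomorphic_deriv[OF holo open_ball])
    show "(\<lambda>z. exp z * (1 + sin z)) holomorphic_on ball 0 1"
      by (intro holomorphic_intros)
    show "\<forall>z\<in>ball 0 1. deriv f z = exp (w z) * (1 + sin (w z))"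
      using d by (auto simp: phi_def)
  qed (rule schwarz_blaschke2)
  then show "f \<in> P_star"
    using schl by (simp add: P_star_def)
  have "\<forall>z\<in>ball 0 1. deriv f z = phi (w z)"
    using d by simp
  note c = log_inverse_coeff_subordinate[OF schl schwarz_blaschke2 this, unfolded blaschke2_coefficients]
  show "log_inverse_coeff f 1 = - of_real a / 2" "log_inverse_coeff f 2 = of_real (a ^ 2 / 2 - k ^ 2 / 3)"
    unfolding c by simp_all
qed

lemma log_inverse_coeff_bounds:
  assumes "f \<in> P_star"
  shows "- (1 / sqrt 10) \<le> norm (log_inverse_coeff f 2) - norm (log_inverse_coeff f 1)"
    and "norm (log_inverse_coeff f 2) - norm (log_inverse_coeff f 1) \<le> 1 / 3"
proof -
  obtain \<omega> where f: "f \<in> schlicht" and w: "schwarz_function \<omega>"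
      and eq: "\<forall>z\<in>ball 0 1. deriv f z = phi (\<omega> z)"
    using assms by (auto simp: P_star_def subordinate_def phi_def)
  show "- (1 / sqrt 10) \<le> norm (log_inverse_coeff f 2) - norm (log_inverse_coeff f 1)"
      "norm (log_inverse_coeff f 2) - norm (log_inverse_coeff f 1) \<le> 1 / 3"
    unfolding log_inverse_coeff_subordinate[OF f w eq]
    using coefficient_estimate[OF schwarz_coefficients(2,3)[OF w]] by simp_all
qed

theorem theorem3p4:
  shows "(\<forall>f\<in>P_star.
            - (1 / sqrt 10) \<le> norm (log_inverse_coeff f 2) - norm (log_inverse_coeff f 1) \<and>
            norm (log_inverse_coeff f 2) - norm (log_inverse_coeff f 1) \<le> 1 / 3) \<and>
         (\<exists>f\<in>P_star.
            norm (log_inverse_coeff f 2) - norm (log_inverse_coeff f 1) = - (1 / sqrt 10)) \<and>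
         (\<exists>f\<in>P_star.
            norm (log_inverse_coeff f 2) - norm (log_inverse_coeff f 1) = 1 / 3)"
proof (intro conjI ballI)
  define a k where "a = sqrt (2/5)" and "k = sqrt (3/5)"
  have sq: "a ^ 2 = 2/5" "k ^ 2 = 3/5"
    by (simp_all add: a_def k_def)
  have "narrow_parameter a k"
    by unfold_locales (simp_all add: sq, simp_all add: a_def k_def)
  then obtain f where f: "narrow_map a k f"
    by (rule narrow_map_exists)
  interpret narrow_map a k f by fact
  have "inj_on f (ball 0 1)"
    by (intro inj_disc arc_bounds_ext[OF f sq(1)])
  note ext = extremal_map[OF this]
  have "a = 2 * (1 / sqrt 10)"
    by (rule power2_eq_imp_eq) (simp_all add: sq power_divide a_def)
  then have "norm (log_inverse_coeff f 2) - norm (log_inverse_coeff f 1) = - (1 / sqrt 10)"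
    unfolding ext(2,3) sq by (simp add: norm_divide)
  then show "\<exists>f\<in>P_star. norm (log_inverse_coeff f 2) - norm (log_inverse_coeff f 1) = - (1 / sqrt 10)"
    using ext(1) by blast
next
  have "narrow_parameter 0 1"
    by unfold_locales simp_all
  then obtain f where f: "narrow_map 0 1 f"
    by (rule narrow_map_exists)
  interpret narrow_map 0 1 f by fact
  have "inj_on f (ball 0 1)"
    using arc_bound_square[OF f, of 1] arc_bound_square[OF f, of "-1"] by (intro inj_disc) simp_all
  note ext = extremal_map[OF this]
  have "norm (log_inverse_coeff f 2) - norm (log_inverse_coeff f 1) = 1 / 3"
    unfolding ext(2,3) by (simp add: norm_divide)
  then show "\<exists>f\<in>P_star. norm (log_inverse_coeff f 2) - norm (log_inverse_coeff f 1) = 1 / 3"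
    using ext(1) by blast
qed (rule log_inverse_coeff_bounds; assumption)+

end
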